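(* Let $A$ be an approximately semi-amenable Banach algebra with a central multiplier-bounded approximate identity, and let $B$ be a Banach function algebra which has a multiplier-bounded approximate identity consisting of elements of finite support. Then the projective tensor product $A\widehat{\otimes}B$ is approximately semi-amenable.
   Context: A Banach function algebra $B$ here is a Banach algebra of complex-valued functions on a set $S$ with pointwise operations; an element has finite support if it vanishes outside a finite subset of $S$. A multiplier-bounded approximate identity of a Banach algebra $C$ is a net $(u_\alpha)$ in $C$ with $u_\alpha c\to c$ for all $c\in C$ and a constant $M$ with $\|u_\alpha c\|\le M\|c\|$ for all $\alpha,c$; it is central if each $u_\alpha$ lies in the centre of $C$. $A\widehat{\otimes}B$ is the Banach algebra with product $(a\otimes b)(a'\otimes b')=aa'\otimes bb'$. For a Banach algebra $C$ and Banach $C$-bimodule $X$, $X^*$ has the dual structure $\langle c\cdot f,x\rangle=\langle f,x\cdot c\rangle$, $\langle f\cdot c,x\rangle=\langle f,c\cdot x\rangle$; a derivation is a linear $D:C\to X^*$ with $D(cd)=c\cdot D(d)+D(c)\cdot d$; it is approximately semi-inner if there are nets $(\xi_i),(\eta_i)$ in $X^*$ with $D(c)=\lim_i(c\cdot\xi_i-\eta_i\cdot c)$ in norm for all $c$. $C$ is approximately semi-amenable if for every Banach $C$-bimodule $X$ every continuous derivation $C\to X^*$ is approximately semi-inner. *)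

theory Defs
  imports "HOL-Analysis.Analysis"
begin

record 'a cvs =
  vcarrier :: "'a set"
  vzero    :: 'a
  vplus    :: "'a \<Rightarrow> 'a \<Rightarrow> 'a"
  vsmul    :: "complex \<Rightarrow> 'a \<Rightarrow> 'a"
  vnorm    :: "'a \<Rightarrow> real"

record 'a calg = "'a cvs" +
  amult :: "'a \<Rightarrow> 'a \<Rightarrow> 'a"

record ('x, 'c) bimod = "'x cvs" +
  lact :: "'c \<Rightarrow> 'x \<Rightarrow> 'x"
  ract :: "'x \<Rightarrow> 'c \<Rightarrow> 'x"

definition vminus :: "('a, 'z) cvs_scheme \<Rightarrow> 'a \<Rightarrow> 'a \<Rightarrow> 'a" where
  "vminus V x y = vplus V x (vsmul V (-1) y)"

definition cbanach :: "('a, 'z) cvs_scheme \<Rightarrow> bool" where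
  "cbanach V \<longleftrightarrow>
     vzero V \<in> vcarrier V \<and>
     (\<forall>x\<in>vcarrier V. \<forall>y\<in>vcarrier V. vplus V x y \<in> vcarrier V) \<and>
     (\<forall>z. \<forall>x\<in>vcarrier V. vsmul V z x \<in> vcarrier V) \<and>
     (\<forall>x\<in>vcarrier V. \<forall>y\<in>vcarrier V. \<forall>w\<in>vcarrier V.
        vplus V (vplus V x y) w = vplus V x (vplus V y w)) \<and>
     (\<forall>x\<in>vcarrier V. \<forall>y\<in>vcarrier V. vplus V x y = vplus V y x) \<and>
     (\<forall>x\<in>vcarrier V. vplus V x (vzero V) = x) \<and>
     (\<forall>x\<in>vcarrier V. vplus V x (vsmul V (-1) x) = vzero V) \<and>
     (\<forall>x\<in>vcarrier V. vsmul V 1 x = x) \<and>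
     (\<forall>a b. \<forall>x\<in>vcarrier V. vsmul V a (vsmul V b x) = vsmul V (a * b) x) \<and>
     (\<forall>a b. \<forall>x\<in>vcarrier V. vsmul V (a + b) x = vplus V (vsmul V a x) (vsmul V b x)) \<and>
     (\<forall>a. \<forall>x\<in>vcarrier V. \<forall>y\<in>vcarrier V.
        vsmul V a (vplus V x y) = vplus V (vsmul V a x) (vsmul V a y)) \<and>
     (\<forall>x\<in>vcarrier V. 0 \<le> vnorm V x) \<and>
     (\<forall>x\<in>vcarrier V. vnorm V x = 0 \<longleftrightarrow> x = vzero V) \<and>
     (\<forall>x\<in>vcarrier V. \<forall>y\<in>vcarrier V. vnorm V (vplus V x y) \<le> vnorm V x + vnorm V y) \<and>
     (\<forall>a. \<forall>x\<in>vcarrier V. vnorm V (vsmul V a x) = cmod a * vnorm V x) \<and>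
     (\<forall>f. (\<forall>n. f n \<in> vcarrier V) \<and>
          (\<forall>e>0. \<exists>N. \<forall>m\<ge>N. \<forall>n\<ge>N. vnorm V (vminus V (f m) (f n)) < e) \<longrightarrow>
          (\<exists>x\<in>vcarrier V. (\<lambda>n. vnorm V (vminus V (f n) x)) \<longlonglongrightarrow> 0))"

definition banach_algebra :: "('a, 'z) calg_scheme \<Rightarrow> bool" where
  "banach_algebra C \<longleftrightarrow> cbanach C \<and>
     (\<forall>x\<in>vcarrier C. \<forall>y\<in>vcarrier C. amult C x y \<in> vcarrier C) \<and>
     (\<forall>x\<in>vcarrier C. \<forall>y\<in>vcarrier C. \<forall>w\<in>vcarrier C.
        amult C (amult C x y) w = amult C x (amult C y w)) \<and>
     (\<forall>x\<in>vcarrier C. \<forall>y\<in>vcarrier C. \<forall>w\<in>vcarrier C.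
        amult C x (vplus C y w) = vplus C (amult C x y) (amult C x w) \<and>
        amult C (vplus C y w) x = vplus C (amult C y x) (amult C w x)) \<and>
     (\<forall>a. \<forall>x\<in>vcarrier C. \<forall>y\<in>vcarrier C.
        amult C (vsmul C a x) y = vsmul C a (amult C x y) \<and>
        amult C x (vsmul C a y) = vsmul C a (amult C x y)) \<and>
     (\<forall>x\<in>vcarrier C. \<forall>y\<in>vcarrier C. vnorm C (amult C x y) \<le> vnorm C x * vnorm C y)"

definition banach_bimodule :: "'c calg \<Rightarrow> ('x, 'c) bimod \<Rightarrow> bool" where
  "banach_bimodule C X \<longleftrightarrow> cbanach X \<and>
     (\<forall>c\<in>vcarrier C. \<forall>x\<in>vcarrier X. lact X c x \<in> vcarrier X \<and> ract X x c \<in> vcarrier X) \<and>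
     (\<forall>c\<in>vcarrier C. \<forall>x\<in>vcarrier X. \<forall>y\<in>vcarrier X.
        lact X c (vplus X x y) = vplus X (lact X c x) (lact X c y) \<and>
        ract X (vplus X x y) c = vplus X (ract X x c) (ract X y c)) \<and>
     (\<forall>c\<in>vcarrier C. \<forall>d\<in>vcarrier C. \<forall>x\<in>vcarrier X.
        lact X (vplus C c d) x = vplus X (lact X c x) (lact X d x) \<and>
        ract X x (vplus C c d) = vplus X (ract X x c) (ract X x d)) \<and>
     (\<forall>a. \<forall>c\<in>vcarrier C. \<forall>x\<in>vcarrier X.
        lact X (vsmul C a c) x = vsmul X a (lact X c x) \<and>
        lact X c (vsmul X a x) = vsmul X a (lact X c x) \<and>
        ract X x (vsmul C a c) = vsmul X a (ract X x c) \<and>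
        ract X (vsmul X a x) c = vsmul X a (ract X x c)) \<and>
     (\<forall>c\<in>vcarrier C. \<forall>d\<in>vcarrier C. \<forall>x\<in>vcarrier X.
        lact X (amult C c d) x = lact X c (lact X d x) \<and>
        ract X x (amult C c d) = ract X (ract X x c) d \<and>
        ract X (lact X c x) d = lact X c (ract X x d)) \<and>
     (\<forall>c\<in>vcarrier C. \<forall>x\<in>vcarrier X.
        vnorm X (lact X c x) \<le> vnorm C c * vnorm X x \<and>
        vnorm X (ract X x c) \<le> vnorm C c * vnorm X x)"

definition dual :: "('x, 'z) cvs_scheme \<Rightarrow> ('x \<Rightarrow> complex) set" where
  "dual X = {f. (\<forall>x\<in>vcarrier X. \<forall>y\<in>vcarrier X. f (vplus X x y) = f x + f y) \<and>
                (\<forall>a. \<forall>x\<in>vcarrier X. f (vsmul X a x) = a * f x) \<and>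
                (\<exists>K. \<forall>x\<in>vcarrier X. cmod (f x) \<le> K * vnorm X x) \<and>
                (\<forall>x. x \<notin> vcarrier X \<longrightarrow> f x = 0)}"

definition dnorm :: "('x, 'z) cvs_scheme \<Rightarrow> ('x \<Rightarrow> complex) \<Rightarrow> real" where
  "dnorm X f = Sup ((\<lambda>x. cmod (f x)) ` {x \<in> vcarrier X. vnorm X x \<le> 1})"

definition dlact :: "('x, 'c) bimod \<Rightarrow> 'c \<Rightarrow> ('x \<Rightarrow> complex) \<Rightarrow> ('x \<Rightarrow> complex)" where
  "dlact X c f = (\<lambda>x. if x \<in> vcarrier X then f (ract X x c) else 0)"

definition dract :: "('x, 'c) bimod \<Rightarrow> ('x \<Rightarrow> complex) \<Rightarrow> 'c \<Rightarrow> ('x \<Rightarrow> complex)" where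
  "dract X f c = (\<lambda>x. if x \<in> vcarrier X then f (lact X c x) else 0)"

definition cont_derivation :: "'c calg \<Rightarrow> ('x, 'c) bimod \<Rightarrow> ('c \<Rightarrow> 'x \<Rightarrow> complex) \<Rightarrow> bool" where
  "cont_derivation C X D \<longleftrightarrow>
     (\<forall>c\<in>vcarrier C. D c \<in> dual X) \<and>
     (\<forall>c\<in>vcarrier C. \<forall>d\<in>vcarrier C. D (vplus C c d) = (\<lambda>x. D c x + D d x)) \<and>
     (\<forall>a. \<forall>c\<in>vcarrier C. D (vsmul C a c) = (\<lambda>x. a * D c x)) \<and>
     (\<exists>K. \<forall>c\<in>vcarrier C. dnorm X (D c) \<le> K * vnorm C c) \<and>
     (\<forall>c\<in>vcarrier C. \<forall>d\<in>vcarrier C.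
        D (amult C c d) = (\<lambda>x. dlact X c (D d) x + dract X (D c) d x))"

text \<open>Approximately semi-inner: nets \<open>(\<xi>\<^sub>i), (\<eta>\<^sub>i)\<close> in \<open>X\<^sup>*\<close> with
  \<open>D c = lim (c\<cdot>\<xi>\<^sub>i - \<eta>\<^sub>i\<cdot>c)\<close> in norm. A net of pairs is represented, as usual in
  Isabelle, by a proper filter on the space of pairs (the image filter of the net).\<close>
definition approx_semi_inner :: "'c calg \<Rightarrow> ('x, 'c) bimod \<Rightarrow> ('c \<Rightarrow> 'x \<Rightarrow> complex) \<Rightarrow> bool" where
  "approx_semi_inner C X D \<longleftrightarrow>
     (\<exists>F :: (('x \<Rightarrow> complex) \<times> ('x \<Rightarrow> complex)) filter.
        F \<noteq> bot \<and>
        eventually (\<lambda>(\<xi>, \<eta>). \<xi> \<in> dual X \<and> \<eta> \<in> dual X) F \<and>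
        (\<forall>c\<in>vcarrier C.
           ((\<lambda>(\<xi>, \<eta>). dnorm X (\<lambda>x. D c x - (dlact X c \<xi> x - dract X \<eta> c x))) \<longlongrightarrow> 0) F))"

definition approx_semi_amenable :: "'x itself \<Rightarrow> 'c calg \<Rightarrow> bool" where
  "approx_semi_amenable _ C \<longleftrightarrow>
     (\<forall>X :: ('x, 'c) bimod. banach_bimodule C X \<longrightarrow>
        (\<forall>D. cont_derivation C X D \<longrightarrow> approx_semi_inner C X D))"

text \<open>Multiplier-bounded approximate identity, given as a net, i.e. a proper filter \<open>F\<close>
  on the algebra (image filter of the net); \<open>P\<close> is an extra property of each member.\<close>
definition mbai_with :: "('a \<Rightarrow> bool) \<Rightarrow> 'a calg \<Rightarrow> 'a filter \<Rightarrow> bool" where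
  "mbai_with P C F \<longleftrightarrow>
     F \<noteq> bot \<and>
     eventually (\<lambda>u. u \<in> vcarrier C \<and> P u) F \<and>
     (\<forall>c\<in>vcarrier C. ((\<lambda>u. vnorm C (vminus C (amult C u c) c)) \<longlongrightarrow> 0) F) \<and>
     (\<exists>M. eventually (\<lambda>u. \<forall>c\<in>vcarrier C. vnorm C (amult C u c) \<le> M * vnorm C c) F)"

definition central :: "'a calg \<Rightarrow> 'a \<Rightarrow> bool" where
  "central C u \<longleftrightarrow> (\<forall>c\<in>vcarrier C. amult C u c = amult C c u)"

definition has_central_mbai :: "'a calg \<Rightarrow> bool" where
  "has_central_mbai C \<longleftrightarrow> (\<exists>F. mbai_with (central C) C F)"

definition banach_function_algebra :: "'s set \<Rightarrow> ('s \<Rightarrow> complex) calg \<Rightarrow> bool" where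
  "banach_function_algebra S B \<longleftrightarrow> banach_algebra B \<and>
     (\<forall>f\<in>vcarrier B. \<forall>s. s \<notin> S \<longrightarrow> f s = 0) \<and>
     vzero B = (\<lambda>s. 0) \<and>
     (\<forall>f\<in>vcarrier B. \<forall>g\<in>vcarrier B. vplus B f g = (\<lambda>s. f s + g s)) \<and>
     (\<forall>a. \<forall>f\<in>vcarrier B. vsmul B a f = (\<lambda>s. a * f s)) \<and>
     (\<forall>f\<in>vcarrier B. \<forall>g\<in>vcarrier B. amult B f g = (\<lambda>s. f s * g s))"

definition finite_support :: "'s set \<Rightarrow> ('s \<Rightarrow> complex) \<Rightarrow> bool" where
  "finite_support S f \<longleftrightarrow> finite {s \<in> S. f s \<noteq> 0}"

definition has_finite_support_mbai :: "'s set \<Rightarrow> ('s \<Rightarrow> complex) calg \<Rightarrow> bool" where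
  "has_finite_support_mbai S B \<longleftrightarrow> (\<exists>F. mbai_with (finite_support S) B F)"

definition bilform :: "'a calg \<Rightarrow> 'b calg \<Rightarrow> ('a \<Rightarrow> 'b \<Rightarrow> complex) \<Rightarrow> bool" where
  "bilform A B \<phi> \<longleftrightarrow>
     (\<forall>a\<in>vcarrier A. \<forall>b\<in>vcarrier B. \<forall>b'\<in>vcarrier B. \<phi> a (vplus B b b') = \<phi> a b + \<phi> a b') \<and>
     (\<forall>a\<in>vcarrier A. \<forall>a'\<in>vcarrier A. \<forall>b\<in>vcarrier B. \<phi> (vplus A a a') b = \<phi> a b + \<phi> a' b) \<and>
     (\<forall>z. \<forall>a\<in>vcarrier A. \<forall>b\<in>vcarrier B.
        \<phi> (vsmul A z a) b = z * \<phi> a b \<and> \<phi> a (vsmul B z b) = z * \<phi> a b) \<and>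
     (\<exists>K. \<forall>a\<in>vcarrier A. \<forall>b\<in>vcarrier B. cmod (\<phi> a b) \<le> K * vnorm A a * vnorm B b)"

definition tensor_rep :: "'a calg \<Rightarrow> 'b calg \<Rightarrow> (nat \<Rightarrow> 'a) \<Rightarrow> (nat \<Rightarrow> 'b) \<Rightarrow> bool" where
  "tensor_rep A B a b \<longleftrightarrow> (\<forall>n. a n \<in> vcarrier A \<and> b n \<in> vcarrier B) \<and>
     summable (\<lambda>n. vnorm A (a n) * vnorm B (b n))"

text \<open>The element \<open>\<Sum>\<^sub>n a\<^sub>n \<otimes> b\<^sub>n\<close> of \<open>A \<otimes>\<^sub>\<pi> B\<close>, realised (via the canonical injective
  embedding \<open>A \<otimes>\<^sub>\<pi> B \<rightarrow> (A \<otimes>\<^sub>\<pi> B)\<^sup>*\<^sup>*\<close>) as a functional on bounded bilinear forms.\<close>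
definition tens_of :: "'a calg \<Rightarrow> 'b calg \<Rightarrow> (nat \<Rightarrow> 'a) \<Rightarrow> (nat \<Rightarrow> 'b)
    \<Rightarrow> (('a \<Rightarrow> 'b \<Rightarrow> complex) \<Rightarrow> complex)" where
  "tens_of A B a b = (\<lambda>\<phi>. if bilform A B \<phi> then (\<Sum>n. \<phi> (a n) (b n)) else 0)"

definition ptensor :: "'a calg \<Rightarrow> 'b calg \<Rightarrow> (('a \<Rightarrow> 'b \<Rightarrow> complex) \<Rightarrow> complex) calg" where
  "ptensor A B =
    \<lparr> vcarrier = {tens_of A B a b | a b. tensor_rep A B a b},
      vzero = (\<lambda>\<phi>. 0),
      vplus = (\<lambda>\<Phi> \<Psi> \<phi>. \<Phi> \<phi> + \<Psi> \<phi>),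
      vsmul = (\<lambda>z \<Phi> \<phi>. z * \<Phi> \<phi>),
      vnorm = (\<lambda>\<Phi>. Inf {(\<Sum>n. vnorm A (a n) * vnorm B (b n)) | a b.
                         tensor_rep A B a b \<and> \<Phi> = tens_of A B a b}),
      amult = (\<lambda>\<Phi> \<Psi> \<phi>. if bilform A B \<phi>
                 then \<Phi> (\<lambda>x y. \<Psi> (\<lambda>x' y'. \<phi> (amult A x x') (amult B y y'))) else 0) \<rparr>"

end

theory Submission
  imports Defs
begin

text \<open>Let \<open>D\<close> be a continuous derivation from the tensor product into a dual bimodule and let
  finitely many \<open>c\<close> be given. With \<open>v\<close> and \<open>u\<close> far out in the two approximate identities,
  multiplier-boundedness gives \<open>D c \<approx> D ((v \<otimes> u) c)\<close>. The finitely supported \<open>u\<close> is a combination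
  of idempotents \<open>e \<in> B\<close> with \<open>e b = b(s) e\<close>, so that \<open>(v \<otimes> e) c = v a \<otimes> e\<close> for some \<open>a \<in> A\<close>.
  On \<open>A \<otimes> e\<close> the map \<open>D\<close> is a derivation of \<open>A\<close>, hence approximated by some \<open>\<xi>, \<eta>\<close>; as \<open>v \<otimes> e\<close>
  is central, \<open>(v \<otimes> e) c \<cdot> \<xi> - \<eta> \<cdot> (v \<otimes> e) c = c \<cdot> ((v \<otimes> e) \<cdot> \<xi>) - (\<eta> \<cdot> (v \<otimes> e)) \<cdot> c\<close>. No bound on
  \<open>\<xi>, \<eta>\<close> is needed because \<open>v\<close> and \<open>u\<close> are chosen first.\<close>

section \<open>Banach spaces, algebras and bimodules given by records\<close>

text \<open>The argument naturally yields semi-innerness: with \<open>w = v \<otimes> e\<close>,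
  even if \<open>\<xi> = \<eta>\<close>, the functionals \<open>w \<cdot> \<xi>\<close> and
  \<open>\<xi> \<cdot> w\<close> that serve for \<open>c\<close> differ in general. The derivation
  identity enters only along \<open>a \<mapsto> a \<otimes> e\<close>, which is multiplicative
  because \<open>e\<close> is idempotent; linearity of \<open>D\<close> then passes from the
  idempotents to \<open>u\<close>, and the comparison of \<open>D c\<close> with
  \<open>D ((v \<otimes> u) c)\<close> is continuity alone. Two obstacles shape the rest. An
  idempotent may have norm greater than 1, so \<open>a \<mapsto> a \<otimes> e\<close> need not be
  contractive, while a Banach bimodule is required to have contractive actions: \<open>X\<close> has
  to be renormed before the hypothesis on \<open>A\<close> applies. And the members of the two nets
  may be unbounded in norm; it is their multiplier bounds, applied to each term of a representing
  series, that allow limit and sum to be exchanged in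
  \<open>(v \<otimes> u) c \<rightarrow> c\<close>.\<close>

lemma
  assumes "cbanach V"
  shows cbanach_zero: "vzero V \<in> vcarrier V"
    and cbanach_plus: "\<And>x y. x \<in> vcarrier V \<Longrightarrow> y \<in> vcarrier V \<Longrightarrow> vplus V x y \<in> vcarrier V"
    and cbanach_smul: "\<And>z x. x \<in> vcarrier V \<Longrightarrow> vsmul V z x \<in> vcarrier V"
    and cbanach_smul_one: "\<And>x. x \<in> vcarrier V \<Longrightarrow> vsmul V 1 x = x"
    and cbanach_smul_smul: "\<And>a b x. x \<in> vcarrier V \<Longrightarrow> vsmul V a (vsmul V b x) = vsmul V (a * b) x"
    and cbanach_assoc: "\<And>x y w. x \<in> vcarrier V \<Longrightarrow> y \<in> vcarrier V \<Longrightarrow> w \<in> vcarrier V \<Longrightarrow>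
          vplus V (vplus V x y) w = vplus V x (vplus V y w)"
    and cbanach_commute: "\<And>x y. x \<in> vcarrier V \<Longrightarrow> y \<in> vcarrier V \<Longrightarrow> vplus V x y = vplus V y x"
    and cbanach_right_inverse: "\<And>x. x \<in> vcarrier V \<Longrightarrow> vplus V x (vsmul V (-1) x) = vzero V"
    and cbanach_smul_plus: "\<And>a x y. x \<in> vcarrier V \<Longrightarrow> y \<in> vcarrier V \<Longrightarrow>
          vsmul V a (vplus V x y) = vplus V (vsmul V a x) (vsmul V a y)"
    and cbanach_norm_ge_0: "\<And>x. x \<in> vcarrier V \<Longrightarrow> 0 \<le> vnorm V x"
    and cbanach_norm_eq_0: "\<And>x. x \<in> vcarrier V \<Longrightarrow> vnorm V x = 0 \<longleftrightarrow> x = vzero V"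
    and cbanach_norm_triangle: "\<And>x y. x \<in> vcarrier V \<Longrightarrow> y \<in> vcarrier V \<Longrightarrow>
          vnorm V (vplus V x y) \<le> vnorm V x + vnorm V y"
    and cbanach_norm_smul: "\<And>a x. x \<in> vcarrier V \<Longrightarrow> vnorm V (vsmul V a x) = cmod a * vnorm V x"
  using assms unfolding cbanach_def by - (elim conjE, metis)+

lemma cbanach_minus:
  "cbanach V \<Longrightarrow> x \<in> vcarrier V \<Longrightarrow> y \<in> vcarrier V \<Longrightarrow> vminus V x y \<in> vcarrier V"
  by (simp add: vminus_def cbanach_plus cbanach_smul)

lemma cbanach_norm_zero: "cbanach V \<Longrightarrow> vnorm V (vzero V) = 0"
  by (simp add: cbanach_norm_eq_0 cbanach_zero)

lemma cbanach_complete: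
  assumes "cbanach V" "\<And>n. f n \<in> vcarrier V"
    and "\<And>e. e > 0 \<Longrightarrow> \<exists>N. \<forall>m\<ge>N. \<forall>n\<ge>N. vnorm V (vminus V (f m) (f n)) < e"
  obtains x where "x \<in> vcarrier V" "(\<lambda>n. vnorm V (vminus V (f n) x)) \<longlonglongrightarrow> 0"
proof -
  have "\<forall>f. (\<forall>n. f n \<in> vcarrier V) \<and>
          (\<forall>e>0. \<exists>N. \<forall>m\<ge>N. \<forall>n\<ge>N. vnorm V (vminus V (f m) (f n)) < e) \<longrightarrow>
          (\<exists>x\<in>vcarrier V. (\<lambda>n. vnorm V (vminus V (f n) x)) \<longlonglongrightarrow> 0)"
    using assms(1) unfolding cbanach_def by (elim conjE)
  from this[rule_format, of f] obtain x where "x \<in> vcarrier V" "(\<lambda>n. vnorm V (vminus V (f n) x)) \<longlonglongrightarrow> 0"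
    using assms(2,3) by auto
  then show ?thesis by (rule that)
qed

lemma
  assumes "banach_algebra C"
  shows banach_algebra_cbanach: "cbanach C"
    and banach_algebra_mult: "\<And>x y. x \<in> vcarrier C \<Longrightarrow> y \<in> vcarrier C \<Longrightarrow> amult C x y \<in> vcarrier C"
    and banach_algebra_distrib_left: "\<And>x y w. x \<in> vcarrier C \<Longrightarrow> y \<in> vcarrier C \<Longrightarrow> w \<in> vcarrier C \<Longrightarrow>
        amult C x (vplus C y w) = vplus C (amult C x y) (amult C x w)"
    and banach_algebra_distrib_right: "\<And>x y w. x \<in> vcarrier C \<Longrightarrow> y \<in> vcarrier C \<Longrightarrow> w \<in> vcarrier C \<Longrightarrow>
        amult C (vplus C y w) x = vplus C (amult C y x) (amult C w x)"
    and banach_algebra_smul_left: "\<And>a x y. x \<in> vcarrier C \<Longrightarrow> y \<in> vcarrier C \<Longrightarrow>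
        amult C (vsmul C a x) y = vsmul C a (amult C x y)"
    and banach_algebra_smul_right: "\<And>a x y. x \<in> vcarrier C \<Longrightarrow> y \<in> vcarrier C \<Longrightarrow>
        amult C x (vsmul C a y) = vsmul C a (amult C x y)"
    and banach_algebra_norm_mult: "\<And>x y. x \<in> vcarrier C \<Longrightarrow> y \<in> vcarrier C \<Longrightarrow>
        vnorm C (amult C x y) \<le> vnorm C x * vnorm C y"
  using assms unfolding banach_algebra_def by - (elim conjE, metis)+

lemma
  assumes "banach_bimodule C X"
  shows bimodule_cbanach: "cbanach X"
    and bimodule_lact: "\<And>c x. c \<in> vcarrier C \<Longrightarrow> x \<in> vcarrier X \<Longrightarrow> lact X c x \<in> vcarrier X"
    and bimodule_ract: "\<And>c x. c \<in> vcarrier C \<Longrightarrow> x \<in> vcarrier X \<Longrightarrow> ract X x c \<in> vcarrier X"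
    and bimodule_lact_plus: "\<And>c x y. c \<in> vcarrier C \<Longrightarrow> x \<in> vcarrier X \<Longrightarrow> y \<in> vcarrier X \<Longrightarrow>
        lact X c (vplus X x y) = vplus X (lact X c x) (lact X c y)"
    and bimodule_ract_plus: "\<And>c x y. c \<in> vcarrier C \<Longrightarrow> x \<in> vcarrier X \<Longrightarrow> y \<in> vcarrier X \<Longrightarrow>
        ract X (vplus X x y) c = vplus X (ract X x c) (ract X y c)"
    and bimodule_plus_lact: "\<And>c d x. c \<in> vcarrier C \<Longrightarrow> d \<in> vcarrier C \<Longrightarrow> x \<in> vcarrier X \<Longrightarrow>
        lact X (vplus C c d) x = vplus X (lact X c x) (lact X d x)"
    and bimodule_plus_ract: "\<And>c d x. c \<in> vcarrier C \<Longrightarrow> d \<in> vcarrier C \<Longrightarrow> x \<in> vcarrier X \<Longrightarrow>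
        ract X x (vplus C c d) = vplus X (ract X x c) (ract X x d)"
    and bimodule_smul_lact: "\<And>a c x. c \<in> vcarrier C \<Longrightarrow> x \<in> vcarrier X \<Longrightarrow>
        lact X (vsmul C a c) x = vsmul X a (lact X c x)"
    and bimodule_lact_smul: "\<And>a c x. c \<in> vcarrier C \<Longrightarrow> x \<in> vcarrier X \<Longrightarrow>
        lact X c (vsmul X a x) = vsmul X a (lact X c x)"
    and bimodule_smul_ract: "\<And>a c x. c \<in> vcarrier C \<Longrightarrow> x \<in> vcarrier X \<Longrightarrow>
        ract X x (vsmul C a c) = vsmul X a (ract X x c)"
    and bimodule_ract_smul: "\<And>a c x. c \<in> vcarrier C \<Longrightarrow> x \<in> vcarrier X \<Longrightarrow>
        ract X (vsmul X a x) c = vsmul X a (ract X x c)"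
    and bimodule_mult_lact: "\<And>c d x. c \<in> vcarrier C \<Longrightarrow> d \<in> vcarrier C \<Longrightarrow> x \<in> vcarrier X \<Longrightarrow>
        lact X (amult C c d) x = lact X c (lact X d x)"
    and bimodule_mult_ract: "\<And>c d x. c \<in> vcarrier C \<Longrightarrow> d \<in> vcarrier C \<Longrightarrow> x \<in> vcarrier X \<Longrightarrow>
        ract X x (amult C c d) = ract X (ract X x c) d"
    and bimodule_ract_lact: "\<And>c d x. c \<in> vcarrier C \<Longrightarrow> d \<in> vcarrier C \<Longrightarrow> x \<in> vcarrier X \<Longrightarrow>
        ract X (lact X c x) d = lact X c (ract X x d)"
    and bimodule_norm_lact: "\<And>c x. c \<in> vcarrier C \<Longrightarrow> x \<in> vcarrier X \<Longrightarrow>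
        vnorm X (lact X c x) \<le> vnorm C c * vnorm X x"
    and bimodule_norm_ract: "\<And>c x. c \<in> vcarrier C \<Longrightarrow> x \<in> vcarrier X \<Longrightarrow>
        vnorm X (ract X x c) \<le> vnorm C c * vnorm X x"
  using assms unfolding banach_bimodule_def by - (elim conjE, metis)+

section \<open>Dual spaces and approximately semi-inner derivations\<close>

lemma dual_bound_nonneg:
  assumes "cbanach X" "f \<in> dual X"
  obtains K where "K \<ge> 0" "\<And>x. x \<in> vcarrier X \<Longrightarrow> cmod (f x) \<le> K * vnorm X x"
proof -
  obtain K where K: "\<And>x. x \<in> vcarrier X \<Longrightarrow> cmod (f x) \<le> K * vnorm X x"
    using assms(2) unfolding dual_def by blast
  have "cmod (f x) \<le> \<bar>K\<bar> * vnorm X x" if "x \<in> vcarrier X" for x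
    using K[OF that] cbanach_norm_ge_0[OF assms(1) that]
    by (meson abs_ge_self mult_right_mono order_trans)
  then show ?thesis using that[of "\<bar>K\<bar>"] by simp
qed

lemma dual_plus: "f \<in> dual X \<Longrightarrow> x \<in> vcarrier X \<Longrightarrow> y \<in> vcarrier X \<Longrightarrow> f (vplus X x y) = f x + f y"
  and dual_smul: "f \<in> dual X \<Longrightarrow> x \<in> vcarrier X \<Longrightarrow> f (vsmul X a x) = a * f x"
  and dual_outside: "f \<in> dual X \<Longrightarrow> x \<notin> vcarrier X \<Longrightarrow> f x = 0"
  unfolding dual_def by blast+

lemma dualI:
  assumes "\<And>x y. x \<in> vcarrier X \<Longrightarrow> y \<in> vcarrier X \<Longrightarrow> f (vplus X x y) = f x + f y"
    and "\<And>a x. x \<in> vcarrier X \<Longrightarrow> f (vsmul X a x) = a * f x"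
    and "\<And>x. x \<in> vcarrier X \<Longrightarrow> cmod (f x) \<le> K * vnorm X x"
    and "\<And>x. x \<notin> vcarrier X \<Longrightarrow> f x = 0"
  shows "f \<in> dual X"
  using assms unfolding dual_def by blast

lemma dual_add:
  assumes X: "cbanach X" and f: "f \<in> dual X" and g: "g \<in> dual X"
  shows "(\<lambda>x. f x + g x) \<in> dual X"
proof -
  obtain K where K: "\<And>x. x \<in> vcarrier X \<Longrightarrow> cmod (f x) \<le> K * vnorm X x"
    using dual_bound_nonneg[OF X f] by metis
  obtain L where L: "\<And>x. x \<in> vcarrier X \<Longrightarrow> cmod (g x) \<le> L * vnorm X x"
    using dual_bound_nonneg[OF X g] by metis
  show ?thesis
  proof (rule dualI)
    show "cmod (f x + g x) \<le> (K + L) * vnorm X x" if "x \<in> vcarrier X" for x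
      using norm_triangle_mono[OF K[OF that] L[OF that]] by (simp add: distrib_right)
  qed (auto simp: dual_plus[OF f] dual_plus[OF g] dual_smul[OF f] dual_smul[OF g]
        dual_outside[OF f] dual_outside[OF g] algebra_simps)
qed

lemma dual_scale:
  assumes X: "cbanach X" and f: "f \<in> dual X"
  shows "(\<lambda>x. z * f x) \<in> dual X"
proof -
  obtain K where K: "\<And>x. x \<in> vcarrier X \<Longrightarrow> cmod (f x) \<le> K * vnorm X x"
    using dual_bound_nonneg[OF X f] by metis
  show ?thesis
  proof (rule dualI)
    show "cmod (z * f x) \<le> (cmod z * K) * vnorm X x" if "x \<in> vcarrier X" for x
      using mult_left_mono[OF K[OF that], of "cmod z"] by (simp add: norm_mult mult.assoc)
  qed (auto simp: dual_plus[OF f] dual_smul[OF f] dual_outside[OF f] algebra_simps)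
qed

lemma dual_diff:
  assumes "cbanach X" "f \<in> dual X" "g \<in> dual X"
  shows "(\<lambda>x. f x - g x) \<in> dual X"
  using dual_add[OF assms(1,2) dual_scale[OF assms(1,3), of "-1"]] by simp

lemma dlact_in_dual:
  assumes M: "banach_bimodule C X" and c: "c \<in> vcarrier C" and f: "f \<in> dual X"
  shows "dlact X c f \<in> dual X"
proof -
  note X = bimodule_cbanach[OF M]
  obtain K where K: "K \<ge> 0" "\<And>x. x \<in> vcarrier X \<Longrightarrow> cmod (f x) \<le> K * vnorm X x"
    using dual_bound_nonneg[OF X f] by metis
  show ?thesis
  proof (rule dualI)
    show "cmod (dlact X c f x) \<le> (K * vnorm C c) * vnorm X x" if x: "x \<in> vcarrier X" for x
    proof -
      have "cmod (f (ract X x c)) \<le> K * vnorm X (ract X x c)"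
        using K(2) bimodule_ract[OF M c x] by blast
      also have "\<dots> \<le> K * (vnorm C c * vnorm X x)"
        using bimodule_norm_ract[OF M c x] K(1) by (rule mult_left_mono)
      finally show ?thesis using x by (simp add: dlact_def mult.assoc)
    qed
  qed (auto simp: dlact_def cbanach_plus[OF X] cbanach_smul[OF X] bimodule_ract_plus[OF M c]
        bimodule_ract_smul[OF M c] bimodule_ract[OF M c] dual_plus[OF f] dual_smul[OF f])
qed

lemma dract_in_dual:
  assumes M: "banach_bimodule C X" and c: "c \<in> vcarrier C" and f: "f \<in> dual X"
  shows "dract X f c \<in> dual X"
proof -
  note X = bimodule_cbanach[OF M]
  obtain K where K: "K \<ge> 0" "\<And>x. x \<in> vcarrier X \<Longrightarrow> cmod (f x) \<le> K * vnorm X x"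
    using dual_bound_nonneg[OF X f] by metis
  show ?thesis
  proof (rule dualI)
    show "cmod (dract X f c x) \<le> (K * vnorm C c) * vnorm X x" if x: "x \<in> vcarrier X" for x
    proof -
      have "cmod (f (lact X c x)) \<le> K * vnorm X (lact X c x)"
        using K(2) bimodule_lact[OF M c x] by blast
      also have "\<dots> \<le> K * (vnorm C c * vnorm X x)"
        using bimodule_norm_lact[OF M c x] K(1) by (rule mult_left_mono)
      finally show ?thesis using x by (simp add: dract_def mult.assoc)
    qed
  qed (auto simp: dract_def cbanach_plus[OF X] cbanach_smul[OF X] bimodule_lact_plus[OF M c]
        bimodule_lact_smul[OF M c] bimodule_lact[OF M c] dual_plus[OF f] dual_smul[OF f])
qed

lemma dnorm_le:
  assumes X: "cbanach X" and b: "\<And>x. x \<in> vcarrier X \<Longrightarrow> cmod (f x) \<le> b * vnorm X x" and "b \<ge> 0"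
  shows "dnorm X f \<le> b"
  unfolding dnorm_def
proof (rule cSUP_least)
  show "{x \<in> vcarrier X. vnorm X x \<le> 1} \<noteq> {}"
    using cbanach_zero[OF X] cbanach_norm_zero[OF X] by force
  show "cmod (f x) \<le> b" if "x \<in> {x \<in> vcarrier X. vnorm X x \<le> 1}" for x
    using b[of x] mult_left_le[of "vnorm X x" b] that \<open>b \<ge> 0\<close> by force
qed

text \<open>Scaling to the unit sphere reduces this to the definition of \<open>dnorm\<close>.
  Membership of \<open>f\<close> in the dual supplies the upper bound without which a real
  \<open>Sup\<close> carries no information.\<close>

lemma dnorm_bound:
  assumes X: "cbanach X" and f: "f \<in> dual X" and x: "x \<in> vcarrier X"
  shows "cmod (f x) \<le> dnorm X f * vnorm X x"
proof (cases "vnorm X x = 0")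
  case True
  \<comment> \<open>A vector of norm 0 is the zero vector; writing it as a zero multiple of itself
    makes homogeneity give \<open>f x = 0\<close>.\<close>
  then have "vsmul X 0 x = x"
    using cbanach_norm_eq_0[OF X] cbanach_norm_smul[OF X x, of 0] cbanach_smul[OF X x] x by auto
  then show ?thesis
    using dual_smul[OF f x, of 0] True by simp
next
  case False
  then have pos: "vnorm X x > 0" using cbanach_norm_ge_0[OF X x] by simp
  obtain K where K: "K \<ge> 0" "\<And>x. x \<in> vcarrier X \<Longrightarrow> cmod (f x) \<le> K * vnorm X x"
    using dual_bound_nonneg[OF X f] by metis
  let ?y = "vsmul X (of_real (inverse (vnorm X x))) x"
  have y: "?y \<in> vcarrier X" using cbanach_smul[OF X x] .
  have ny: "vnorm X ?y = 1"
    using pos by (simp add: cbanach_norm_smul[OF X x] norm_inverse)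
  have "bdd_above ((\<lambda>x. cmod (f x)) ` {x \<in> vcarrier X. vnorm X x \<le> 1})"
    using K mult_left_le[of _ K] by (intro bdd_aboveI2[where M=K]) force
  then have "cmod (f ?y) \<le> dnorm X f"
    unfolding dnorm_def using y ny by (intro cSUP_upper) auto
  then show ?thesis using pos
    by (simp add: dual_smul[OF f x] norm_mult norm_inverse norm_divide field_simps)
qed

lemma dnorm_nonneg:
  assumes X: "cbanach X" and f: "f \<in> dual X"
  shows "dnorm X f \<ge> 0"
proof -
  obtain K where K: "K \<ge> 0" "\<And>x. x \<in> vcarrier X \<Longrightarrow> cmod (f x) \<le> K * vnorm X x"
    using dual_bound_nonneg[OF X f] by metis
  have "bdd_above ((\<lambda>x. cmod (f x)) ` {x \<in> vcarrier X. vnorm X x \<le> 1})"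
    using K mult_left_le[of _ K] by (intro bdd_aboveI2[where M=K]) force
  then have "cmod (f (vzero X)) \<le> dnorm X f"
    unfolding dnorm_def using cbanach_zero[OF X] cbanach_norm_zero[OF X]
    by (intro cSUP_upper) auto
  then show ?thesis using norm_ge_zero order_trans by blast
qed

lemma defect_in_dual:
  assumes M: "banach_bimodule C X" and D: "D c \<in> dual X" and c: "c \<in> vcarrier C"
    and "\<xi> \<in> dual X" "\<eta> \<in> dual X"
  shows "(\<lambda>x. D c x - (dlact X c \<xi> x - dract X \<eta> c x)) \<in> dual X"
  using assms by (intro dual_diff bimodule_cbanach[OF M] dlact_in_dual[OF M] dract_in_dual[OF M])

text \<open>The net is traded for the finite form used from here on: finitely many eventual
  conditions hold at a common pair. The error is stated pointwise against \<open>vnorm\<close>, so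
  that later changes of norm and sums of errors avoid suprema.\<close>

lemma approx_semi_innerD:
  assumes M: "banach_bimodule C X" and D: "\<And>c. c \<in> vcarrier C \<Longrightarrow> D c \<in> dual X"
    and asi: "approx_semi_inner C X D"
    and Phi: "finite \<Phi>" "\<Phi> \<subseteq> vcarrier C" and e: "e > 0"
  obtains \<xi> \<eta> where "\<xi> \<in> dual X" "\<eta> \<in> dual X"
    "\<And>c x. c \<in> \<Phi> \<Longrightarrow> x \<in> vcarrier X \<Longrightarrow>
        cmod (D c x - (\<xi> (ract X x c) - \<eta> (lact X c x))) \<le> e * vnorm X x"
proof -
  note X = bimodule_cbanach[OF M]
  obtain F where F: "F \<noteq> bot" "eventually (\<lambda>(\<xi>, \<eta>). \<xi> \<in> dual X \<and> \<eta> \<in> dual X) F"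
    "\<And>c. c \<in> vcarrier C \<Longrightarrow>
       ((\<lambda>(\<xi>, \<eta>). dnorm X (\<lambda>x. D c x - (dlact X c \<xi> x - dract X \<eta> c x))) \<longlongrightarrow> 0) F"
    using asi unfolding approx_semi_inner_def by blast
  have "eventually (\<lambda>(\<xi>, \<eta>). dnorm X (\<lambda>x. D c x - (dlact X c \<xi> x - dract X \<eta> c x)) < e) F"
    if "c \<in> \<Phi>" for c
    using order_tendstoD(2)[OF F(3) e, of c] that Phi by (auto simp: case_prod_unfold)
  then have "eventually (\<lambda>p. \<forall>c\<in>\<Phi>. case p of (\<xi>, \<eta>) \<Rightarrow>
      dnorm X (\<lambda>x. D c x - (dlact X c \<xi> x - dract X \<eta> c x)) < e) F"
    using Phi(1) by (intro eventually_ball_finite) auto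
  from eventually_happens'[OF F(1) eventually_conj[OF F(2) this]]
  obtain \<xi> \<eta> where p: "\<xi> \<in> dual X" "\<eta> \<in> dual X"
    "\<And>c. c \<in> \<Phi> \<Longrightarrow> dnorm X (\<lambda>x. D c x - (dlact X c \<xi> x - dract X \<eta> c x)) < e"
    by auto
  show ?thesis
  proof (rule that[OF p(1,2)])
    fix c x assume c: "c \<in> \<Phi>" and x: "x \<in> vcarrier X"
    then have "c \<in> vcarrier C" using Phi by blast
    from dnorm_bound[OF X defect_in_dual[of C X D, OF M D[OF this] this p(1,2)] x]
    have "cmod (D c x - (\<xi> (ract X x c) - \<eta> (lact X c x)))
        \<le> dnorm X (\<lambda>x. D c x - (dlact X c \<xi> x - dract X \<eta> c x)) * vnorm X x"
      using x by (simp add: dlact_def dract_def)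
    also have "\<dots> \<le> e * vnorm X x"
      using p(3)[OF c] cbanach_norm_ge_0[OF X x] by (intro mult_right_mono) auto
    finally show "cmod (D c x - (\<xi> (ract X x c) - \<eta> (lact X c x))) \<le> e * vnorm X x" .
  qed
qed

text \<open>Converse of the finite form: the pairs that are good for a finite set and a tolerance
  form nonempty sets, directed under intersection, and the filter they generate is the required
  net.\<close>

lemma approx_semi_innerI:
  assumes M: "banach_bimodule C X" and D: "\<And>c. c \<in> vcarrier C \<Longrightarrow> D c \<in> dual X"
    and fin: "\<And>\<Phi> e. finite \<Phi> \<Longrightarrow> \<Phi> \<subseteq> vcarrier C \<Longrightarrow> e > 0 \<Longrightarrow>
      \<exists>\<xi>\<in>dual X. \<exists>\<eta>\<in>dual X. \<forall>c\<in>\<Phi>. \<forall>x\<in>vcarrier X.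
        cmod (D c x - (\<xi> (ract X x c) - \<eta> (lact X c x))) \<le> e * vnorm X x"
  shows "approx_semi_inner C X D"
proof -
  note X = bimodule_cbanach[OF M]
  define Q where "Q = (\<lambda>(\<Phi>, e::real). {(\<xi>, \<eta>). \<xi> \<in> dual X \<and> \<eta> \<in> dual X \<and>
     (\<forall>c\<in>\<Phi>. dnorm X (\<lambda>x. D c x - (dlact X c \<xi> x - dract X \<eta> c x)) \<le> e)})"
  define I where "I = {(\<Phi>, e::real). finite \<Phi> \<and> \<Phi> \<subseteq> vcarrier C \<and> e > 0}"
  define F where "F = (INF i\<in>I. principal (Q i))"
  have ne: "Q i \<noteq> {}" if "i \<in> I" for i
  proof -
    obtain \<Phi> e where i: "i = (\<Phi>, e)" "finite \<Phi>" "\<Phi> \<subseteq> vcarrier C" "e > 0"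
      using \<open>i \<in> I\<close> unfolding I_def by blast
    from fin[OF i(2-4)] obtain \<xi> \<eta> where p: "\<xi> \<in> dual X" "\<eta> \<in> dual X"
      "\<And>c x. c \<in> \<Phi> \<Longrightarrow> x \<in> vcarrier X \<Longrightarrow>
          cmod (D c x - (\<xi> (ract X x c) - \<eta> (lact X c x))) \<le> e * vnorm X x"
      by blast
    have "dnorm X (\<lambda>x. D c x - (dlact X c \<xi> x - dract X \<eta> c x)) \<le> e" if "c \<in> \<Phi>" for c
      using p(3)[OF that] i(4) by (intro dnorm_le[OF X]) (auto simp: dlact_def dract_def)
    then show ?thesis using p(1,2) unfolding i(1) Q_def by auto
  qed
  have base: "eventually P F \<longleftrightarrow> (\<exists>i\<in>I. eventually P (principal (Q i)))" for P
    unfolding F_def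
  proof (rule eventually_INF_base)
    have "({}, 1) \<in> I" unfolding I_def by simp
    then show "I \<noteq> {}" by blast
    fix a b assume "a \<in> I" "b \<in> I"
    \<comment> \<open>Directedness: a larger finite set and a smaller tolerance satisfy both
      requirements.\<close>
    then have "(fst a \<union> fst b, min (snd a) (snd b)) \<in> I"
      and "Q (fst a \<union> fst b, min (snd a) (snd b)) \<subseteq> Q a \<inter> Q b"
      unfolding I_def Q_def by (auto simp: case_prod_unfold)
    then show "\<exists>x\<in>I. principal (Q x) \<le> inf (principal (Q a)) (principal (Q b))"
      by (intro bexI) simp_all
  qed
  have "F \<noteq> bot"
    using ne unfolding trivial_limit_def base eventually_principal by blast
  moreover have "eventually (\<lambda>(\<xi>, \<eta>). \<xi> \<in> dual X \<and> \<eta> \<in> dual X) F"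
    unfolding base by (rule bexI[of _ "({}, 1)"]) (auto simp: I_def Q_def eventually_principal)
  moreover have "((\<lambda>(\<xi>, \<eta>). dnorm X (\<lambda>x. D c x - (dlact X c \<xi> x - dract X \<eta> c x))) \<longlongrightarrow> 0) F"
    if c: "c \<in> vcarrier C" for c
  proof (rule tendstoI)
    fix e :: real assume e: "e > 0"
    show "eventually (\<lambda>p. dist (case p of (\<xi>, \<eta>) \<Rightarrow>
        dnorm X (\<lambda>x. D c x - (dlact X c \<xi> x - dract X \<eta> c x))) 0 < e) F"
      unfolding base
    \<comment> \<open>The sets \<open>Q\<close> use the non-strict bound that
      \<open>dnorm_le\<close> provides, while a limit asks for a strict one; halving
      \<open>e\<close> bridges the gap.\<close>
    proof (rule bexI[of _ "({c}, e / 2)"])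
      show "({c}, e / 2) \<in> I" using c e by (simp add: I_def)
      show "eventually (\<lambda>p. dist (case p of (\<xi>, \<eta>) \<Rightarrow>
          dnorm X (\<lambda>x. D c x - (dlact X c \<xi> x - dract X \<eta> c x))) 0 < e) (principal (Q ({c}, e / 2)))"
        using dnorm_nonneg[OF X defect_in_dual[of C X D, OF M D[OF c] c]] e
        by (auto simp: Q_def eventually_principal)
    qed
  qed
  ultimately show ?thesis unfolding approx_semi_inner_def by blast
qed

section \<open>Pulling back a bimodule along a bounded homomorphism\<close>

text \<open>Equivalent norms have the same Cauchy sequences and limits, and every axiom free of the
  norm is inherited. For homogeneity one inequality suffices, because the other follows by scaling
  back.\<close>

lemma cbanach_renorm:
  assumes V: "cbanach V"
    and same: "vcarrier W = vcarrier V" "vzero W = vzero V" "vplus W = vplus V" "vsmul W = vsmul V"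
    and lower: "\<And>x. x \<in> vcarrier V \<Longrightarrow> vnorm V x \<le> vnorm W x"
    and upper: "\<And>x. x \<in> vcarrier V \<Longrightarrow> vnorm W x \<le> L * vnorm V x"
    and triangle: "\<And>x y. x \<in> vcarrier V \<Longrightarrow> y \<in> vcarrier V \<Longrightarrow>
        vnorm W (vplus V x y) \<le> vnorm W x + vnorm W y"
    and smul: "\<And>a x. x \<in> vcarrier V \<Longrightarrow> vnorm W (vsmul V a x) \<le> cmod a * vnorm W x"
  shows "cbanach W"
proof -
  have nonneg: "0 \<le> vnorm W x" if "x \<in> vcarrier V" for x
    using lower[OF that] cbanach_norm_ge_0[OF V that] by linarith
  have zero: "vnorm W x = 0 \<longleftrightarrow> x = vzero V" if x: "x \<in> vcarrier V" for x
  proof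
    assume "vnorm W x = 0"
    then have "vnorm V x = 0" using lower[OF x] cbanach_norm_ge_0[OF V x] by linarith
    then show "x = vzero V" by (simp only: cbanach_norm_eq_0[OF V x])
  next
    assume "x = vzero V"
    then have "vnorm V x = 0" by (simp add: cbanach_norm_zero[OF V])
    then show "vnorm W x = 0" using upper[OF x] nonneg[OF x] by simp
  qed
  have hom: "vnorm W (vsmul V a x) = cmod a * vnorm W x" if x: "x \<in> vcarrier V" for a x
  proof (cases "a = 0")
    case True
    then have "vnorm V (vsmul V a x) = 0"
      by (simp add: cbanach_norm_smul[OF V x])
    then have "vsmul V a x = vzero V"
      by (simp only: cbanach_norm_eq_0[OF V cbanach_smul[OF V x]])
    then have "vnorm W (vsmul V a x) = 0"
      by (rule zero[OF cbanach_smul[OF V x], THEN iffD2])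
    then show ?thesis using True by simp
  next
    case False
    \<comment> \<open>Applying the assumed inequality to \<open>inverse a\<close> and
      \<open>vsmul V a x\<close> gives the reverse inequality for \<open>a\<close> and
      \<open>x\<close>.\<close>
    have "vnorm W x = vnorm W (vsmul V (inverse a) (vsmul V a x))"
      using False by (simp add: cbanach_smul_smul[OF V x] cbanach_smul_one[OF V x])
    also have "\<dots> \<le> cmod (inverse a) * vnorm W (vsmul V a x)"
      by (rule smul[OF cbanach_smul[OF V x]])
    finally have "cmod a * vnorm W x \<le> vnorm W (vsmul V a x)"
      using False by (simp add: norm_inverse norm_divide field_simps)
    then show ?thesis using smul[OF x, of a] by simp
  qed
  have complete: "\<exists>x\<in>vcarrier V. (\<lambda>n. vnorm W (vminus V (f n) x)) \<longlonglongrightarrow> 0"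
    if f: "\<forall>n. f n \<in> vcarrier V"
      and C: "\<forall>e>0. \<exists>N. \<forall>m\<ge>N. \<forall>n\<ge>N. vnorm W (vminus V (f m) (f n)) < e" for f
  proof -
    have fn: "f n \<in> vcarrier V" for n using f by blast
    have "\<exists>N. \<forall>m\<ge>N. \<forall>n\<ge>N. vnorm V (vminus V (f m) (f n)) < e" if "e > 0" for e
      using C[rule_format, OF that] le_less_trans[OF lower[OF cbanach_minus[OF V fn fn]]] by blast
    from cbanach_complete[OF V fn this] obtain x
      where x: "x \<in> vcarrier V" "(\<lambda>n. vnorm V (vminus V (f n) x)) \<longlonglongrightarrow> 0" .
    have "(\<lambda>n. vnorm W (vminus V (f n) x)) \<longlonglongrightarrow> 0"
    proof (rule Lim_null_comparison)
      show "\<forall>\<^sub>F n in sequentially. norm (vnorm W (vminus V (f n) x)) \<le> L * vnorm V (vminus V (f n) x)"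
        using upper[OF cbanach_minus[OF V fn x(1)]] nonneg[OF cbanach_minus[OF V fn x(1)]]
        by simp
      show "(\<lambda>n. L * vnorm V (vminus V (f n) x)) \<longlonglongrightarrow> 0"
        using tendsto_mult_left[OF x(2), of L] by simp
    qed
    then show ?thesis using x(1) by blast
  qed
  have vm: "vminus W = vminus V"
    unfolding vminus_def same by simp
  show ?thesis
    unfolding cbanach_def same vm
  proof (intro conjI; (insert V[unfolded cbanach_def], elim conjE, assumption)?)
    show "\<forall>x\<in>vcarrier V. 0 \<le> vnorm W x" using nonneg by blast
    show "\<forall>x\<in>vcarrier V. (vnorm W x = 0) = (x = vzero V)" using zero by blast
    show "\<forall>x\<in>vcarrier V. \<forall>y\<in>vcarrier V. vnorm W (vplus V x y) \<le> vnorm W x + vnorm W y"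
      using triangle by blast
    show "\<forall>a. \<forall>x\<in>vcarrier V. vnorm W (vsmul V a x) = cmod a * vnorm W x" using hom by blast
    show "\<forall>f. (\<forall>n. f n \<in> vcarrier V) \<and>
        (\<forall>e>0. \<exists>N. \<forall>m\<ge>N. \<forall>n\<ge>N. vnorm W (vminus V (f m) (f n)) < e) \<longrightarrow>
        (\<exists>x\<in>vcarrier V. (\<lambda>n. vnorm W (vminus V (f n) x)) \<longlonglongrightarrow> 0)"
      using complete by (intro allI impI) (elim conjE)
  qed
qed

text \<open>\<open>C\<close> is a bare record on which \<open>X\<close> is a bimodule, so
  nonnegativity of the norm on the image of \<open>h\<close> has to be listed. Having
  \<open>K \<ge> 1\<close> lets the single factor \<open>K\<^sup>2\<close> dominate the constants 1,
  \<open>K\<close> and \<open>K\<^sup>2\<close> that occur for no, one or two actions.\<close>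

locale algebra_hom_bimodule =
  fixes A :: "'a calg" and C :: "'c calg" and h :: "'a \<Rightarrow> 'c" and X :: "('x, 'c) bimod" and K :: real
  assumes A: "banach_algebra A"
    and M: "banach_bimodule C X"
    and h_carrier: "a \<in> vcarrier A \<Longrightarrow> h a \<in> vcarrier C"
    and h_plus: "a \<in> vcarrier A \<Longrightarrow> b \<in> vcarrier A \<Longrightarrow> h (vplus A a b) = vplus C (h a) (h b)"
    and h_smul: "a \<in> vcarrier A \<Longrightarrow> h (vsmul A z a) = vsmul C z (h a)"
    and h_mult: "a \<in> vcarrier A \<Longrightarrow> b \<in> vcarrier A \<Longrightarrow> h (amult A a b) = amult C (h a) (h b)"
    and h_norm_nonneg: "a \<in> vcarrier A \<Longrightarrow> 0 \<le> vnorm C (h a)"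
    and h_bound: "a \<in> vcarrier A \<Longrightarrow> vnorm C (h a) \<le> K * vnorm A a"
    and K_ge_1: "K \<ge> 1"
begin

lemma X: "cbanach X"
  using bimodule_cbanach[OF M] .

text \<open>The least such \<open>k\<close> is the maximum of the norm of \<open>x\<close> and of
  the suprema of the norms of \<open>a x\<close>, \<open>x b\<close> and \<open>a x b\<close> over
  the unit ball of \<open>A\<close>. Stating the clauses as inequalities linear in \<open>k\<close>
  avoids nested suprema. The mixed clause is what makes the resulting norm stable under acting on
  one side and measuring on the other.\<close>

definition action_bound :: "'x \<Rightarrow> real \<Rightarrow> bool" where
  "action_bound x k \<longleftrightarrow> vnorm X x \<le> k \<and>
     (\<forall>a\<in>vcarrier A. vnorm X (lact X (h a) x) \<le> k * vnorm A a) \<and>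
     (\<forall>b\<in>vcarrier A. vnorm X (ract X x (h b)) \<le> k * vnorm A b) \<and>
     (\<forall>a\<in>vcarrier A. \<forall>b\<in>vcarrier A.
        vnorm X (lact X (h a) (ract X x (h b))) \<le> k * (vnorm A a * vnorm A b))"

definition pnorm :: "'x \<Rightarrow> real" where
  "pnorm x = Inf {k. action_bound x k}"

text \<open>Since \<open>h\<close> need not be contractive, the pulled-back actions are only bounded on \<open>X\<close>;
  \<open>pnorm\<close> is the equivalent norm for which they become contractive.\<close>
definition pullback :: "('x, 'a) bimod" where
  "pullback = \<lparr>vcarrier = vcarrier X, vzero = vzero X, vplus = vplus X, vsmul = vsmul X, vnorm = pnorm,
     lact = (\<lambda>a x. lact X (h a) x), ract = (\<lambda>x a. ract X x (h a))\<rparr>"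

lemma pullback_simps:
  "vcarrier pullback = vcarrier X" "vzero pullback = vzero X" "vplus pullback = vplus X"
  "vsmul pullback = vsmul X" "vnorm pullback = pnorm"
  "lact pullback a x = lact X (h a) x" "ract pullback x a = ract X x (h a)"
  by (simp_all add: pullback_def)

lemma norm_A: "a \<in> vcarrier A \<Longrightarrow> vnorm A a \<ge> 0"
  using cbanach_norm_ge_0[OF banach_algebra_cbanach[OF A]] .

lemma action_bound_exists:
  assumes x: "x \<in> vcarrier X"
  shows "action_bound x (K\<^sup>2 * vnorm X x)"
proof -
  have nx: "vnorm X x \<ge> 0" using cbanach_norm_ge_0[OF X x] .
  have l: "vnorm X (lact X (h a) y) \<le> K * (vnorm A a * vnorm X y)"
    if "a \<in> vcarrier A" "y \<in> vcarrier X" for a y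
    using bimodule_norm_lact[OF M h_carrier, OF that]
      mult_right_mono[OF h_bound[OF that(1)] cbanach_norm_ge_0[OF X that(2)]] by simp
  have r: "vnorm X (ract X y (h a)) \<le> K * (vnorm A a * vnorm X y)"
    if "a \<in> vcarrier A" "y \<in> vcarrier X" for a y
    using bimodule_norm_ract[OF M h_carrier, OF that]
      mult_right_mono[OF h_bound[OF that(1)] cbanach_norm_ge_0[OF X that(2)]] by simp
  have KK: "K * t \<le> K\<^sup>2 * t" "t \<le> K\<^sup>2 * t" if "t \<ge> 0" for t
    using that K_ge_1 by (auto intro!: mult_right_mono mult_left_le_one_le simp: power2_eq_square
        mult_le_cancel_right1 mult_ge1_I[of K K])
  show ?thesis
    unfolding action_bound_def
  proof (intro conjI ballI)
    show "vnorm X x \<le> K\<^sup>2 * vnorm X x" using KK nx by blast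
    fix a assume a: "a \<in> vcarrier A"
    have p: "vnorm A a * vnorm X x \<ge> 0" using norm_A[OF a] nx by simp
    show "vnorm X (lact X (h a) x) \<le> K\<^sup>2 * vnorm X x * vnorm A a"
      using l[OF a x] KK(1)[OF p] by (simp add: mult_ac)
    show "vnorm X (ract X x (h a)) \<le> K\<^sup>2 * vnorm X x * vnorm A a"
      using r[OF a x] KK(1)[OF p] by (simp add: mult_ac)
    fix b assume b: "b \<in> vcarrier A"
    have "vnorm X (lact X (h a) (ract X x (h b))) \<le> K * (vnorm A a * vnorm X (ract X x (h b)))"
      by (rule l[OF a bimodule_ract[OF M h_carrier[OF b] x]])
    also have "\<dots> \<le> K * (vnorm A a * (K * (vnorm A b * vnorm X x)))"
      using r[OF b x] norm_A[OF a] K_ge_1 by (intro mult_left_mono) auto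
    finally show "vnorm X (lact X (h a) (ract X x (h b))) \<le> K\<^sup>2 * vnorm X x * (vnorm A a * vnorm A b)"
      by (simp add: power2_eq_square mult_ac)
  qed
qed

lemma pnorm_le:
  assumes "x \<in> vcarrier X" "action_bound x k"
  shows "pnorm x \<le> k"
  unfolding pnorm_def
proof (rule cInf_lower)
  show "k \<in> {k. action_bound x k}" using assms by simp
  show "bdd_below {k. action_bound x k}"
    by (rule bdd_belowI[of _ "vnorm X x"]) (simp add: action_bound_def)
qed

text \<open>The infimum is attained, since each clause is a closed condition on
  \<open>k\<close>.\<close>

lemma action_bound_pnorm:
  assumes x: "x \<in> vcarrier X"
  shows "action_bound x (pnorm x)"
proof -
  \<comment> \<open>All clauses have the shape \<open>t \<le> k * s\<close>. For
    \<open>s > 0\<close>, division turns \<open>t / s\<close> into a lower bound of the admissible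
    \<open>k\<close>; for \<open>s = 0\<close> the clause does not depend on
    \<open>k\<close>.\<close>
  have le: "t \<le> pnorm x * s" if "s \<ge> 0" "\<And>k. action_bound x k \<Longrightarrow> t \<le> k * s" for s t
  proof (cases "s = 0")
    case True
    then show ?thesis using that(2)[OF action_bound_exists[OF x]] by simp
  next
    case False
    then have "s > 0" using that(1) by simp
    have "t / s \<le> pnorm x"
      unfolding pnorm_def
      using action_bound_exists[OF x] that(2) \<open>s > 0\<close>
      by (intro cInf_greatest) (auto simp: field_simps)
    then show ?thesis using \<open>s > 0\<close> by (simp add: field_simps)
  qed
  have "vnorm X x \<le> pnorm x * 1"
    by (rule le) (auto simp: action_bound_def)
  then show ?thesis
    unfolding action_bound_def using norm_A
    by (intro conjI ballI le) (auto simp: action_bound_def)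
qed

lemma pnorm_lower: "x \<in> vcarrier X \<Longrightarrow> vnorm X x \<le> pnorm x"
  and pnorm_lact: "x \<in> vcarrier X \<Longrightarrow> a \<in> vcarrier A \<Longrightarrow>
        vnorm X (lact X (h a) x) \<le> pnorm x * vnorm A a"
  and pnorm_ract: "x \<in> vcarrier X \<Longrightarrow> a \<in> vcarrier A \<Longrightarrow>
        vnorm X (ract X x (h a)) \<le> pnorm x * vnorm A a"
  and pnorm_lact_ract: "x \<in> vcarrier X \<Longrightarrow> a \<in> vcarrier A \<Longrightarrow> b \<in> vcarrier A \<Longrightarrow>
        vnorm X (lact X (h a) (ract X x (h b))) \<le> pnorm x * (vnorm A a * vnorm A b)"
  using action_bound_pnorm unfolding action_bound_def by blast+

lemma pnorm_upper: "x \<in> vcarrier X \<Longrightarrow> pnorm x \<le> K\<^sup>2 * vnorm X x"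
  using pnorm_le action_bound_exists by blast

lemma pnorm_nonneg: "x \<in> vcarrier X \<Longrightarrow> pnorm x \<ge> 0"
  using pnorm_lower cbanach_norm_ge_0[OF X] order_trans by blast

lemma pnorm_triangle:
  assumes x: "x \<in> vcarrier X" and y: "y \<in> vcarrier X"
  shows "pnorm (vplus X x y) \<le> pnorm x + pnorm y"
proof (rule pnorm_le[OF cbanach_plus[OF X x y]])
  have tri: "vnorm X (vplus X s t) \<le> u + w"
    if "s \<in> vcarrier X" "t \<in> vcarrier X" "vnorm X s \<le> u" "vnorm X t \<le> w" for s t u w
    using cbanach_norm_triangle[OF X that(1,2)] that(3,4) by linarith
  show "action_bound (vplus X x y) (pnorm x + pnorm y)"
    unfolding action_bound_def
    using x y
    by (auto intro!: tri pnorm_lower pnorm_lact pnorm_ract pnorm_lact_ract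
        simp: bimodule_lact_plus[OF M] bimodule_ract_plus[OF M] h_carrier
          bimodule_lact[OF M] bimodule_ract[OF M] distrib_right)
qed

lemma pnorm_smul:
  assumes x: "x \<in> vcarrier X"
  shows "pnorm (vsmul X z x) \<le> cmod z * pnorm x"
proof (rule pnorm_le[OF cbanach_smul[OF X x]])
  show "action_bound (vsmul X z x) (cmod z * pnorm x)"
    unfolding action_bound_def
    using x
    by (auto intro!: mult_left_mono pnorm_lower pnorm_lact pnorm_ract pnorm_lact_ract
        simp: bimodule_lact_smul[OF M] bimodule_ract_smul[OF M] h_carrier
          bimodule_lact[OF M] bimodule_ract[OF M] cbanach_norm_smul[OF X] mult.assoc)
qed

text \<open>Two left actions merge into the action of \<open>amult A a c\<close>, and
  submultiplicativity of the norm of \<open>A\<close> releases the factor \<open>vnorm A c\<close>;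
  no power of \<open>K\<close> appears.\<close>

lemma pnorm_contractive_lact:
  assumes x: "x \<in> vcarrier X" and c: "c \<in> vcarrier A"
  shows "pnorm (lact X (h c) x) \<le> vnorm A c * pnorm x"
proof (rule pnorm_le[OF bimodule_lact[OF M h_carrier[OF c] x]])
  have sub: "pnorm x * vnorm A (amult A a c) \<le> vnorm A c * pnorm x * vnorm A a"
    if "a \<in> vcarrier A" for a
    using mult_left_mono[OF banach_algebra_norm_mult[OF A that c] pnorm_nonneg[OF x]]
    by (simp add: mult_ac)
  show "action_bound (lact X (h c) x) (vnorm A c * pnorm x)"
    unfolding action_bound_def
  proof (intro conjI ballI)
    show "vnorm X (lact X (h c) x) \<le> vnorm A c * pnorm x"
      using pnorm_lact[OF x c] by (simp add: mult.commute)
    fix a assume a: "a \<in> vcarrier A"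
    have "lact X (h a) (lact X (h c) x) = lact X (h (amult A a c)) x"
      using a c x by (simp add: h_mult bimodule_mult_lact[OF M] h_carrier)
    then show "vnorm X (lact X (h a) (lact X (h c) x)) \<le> vnorm A c * pnorm x * vnorm A a"
      using pnorm_lact[OF x banach_algebra_mult[OF A a c]] sub[OF a] by simp
    \<comment> \<open>A right action after a left one cannot be merged; this is where the mixed
      clause is needed.\<close>
    have "ract X (lact X (h c) x) (h a) = lact X (h c) (ract X x (h a))"
      using a c x by (simp add: bimodule_ract_lact[OF M] h_carrier)
    then show "vnorm X (ract X (lact X (h c) x) (h a)) \<le> vnorm A c * pnorm x * vnorm A a"
      using pnorm_lact_ract[OF x c a] by (simp add: mult_ac)
    fix b assume b: "b \<in> vcarrier A"
    have "lact X (h a) (ract X (lact X (h c) x) (h b)) = lact X (h (amult A a c)) (ract X x (h b))"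
      using a b c x by (simp add: h_mult bimodule_mult_lact[OF M] bimodule_ract_lact[OF M]
          bimodule_ract[OF M] h_carrier)
    then show "vnorm X (lact X (h a) (ract X (lact X (h c) x) (h b)))
        \<le> vnorm A c * pnorm x * (vnorm A a * vnorm A b)"
      using pnorm_lact_ract[OF x banach_algebra_mult[OF A a c] b]
        mult_right_mono[OF sub[OF a] norm_A[OF b]] by (simp add: mult_ac)
  qed
qed

lemma pnorm_contractive_ract:
  assumes x: "x \<in> vcarrier X" and c: "c \<in> vcarrier A"
  shows "pnorm (ract X x (h c)) \<le> vnorm A c * pnorm x"
proof (rule pnorm_le[OF bimodule_ract[OF M h_carrier[OF c] x]])
  have sub: "pnorm x * vnorm A (amult A c b) \<le> vnorm A c * pnorm x * vnorm A b"
    if "b \<in> vcarrier A" for b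
    using mult_left_mono[OF banach_algebra_norm_mult[OF A c that] pnorm_nonneg[OF x]]
    by (simp add: mult_ac)
  show "action_bound (ract X x (h c)) (vnorm A c * pnorm x)"
    unfolding action_bound_def
  proof (intro conjI ballI)
    show "vnorm X (ract X x (h c)) \<le> vnorm A c * pnorm x"
      using pnorm_ract[OF x c] by (simp add: mult.commute)
    fix a assume a: "a \<in> vcarrier A"
    show "vnorm X (lact X (h a) (ract X x (h c))) \<le> vnorm A c * pnorm x * vnorm A a"
      using pnorm_lact_ract[OF x a c] by (simp add: mult_ac)
    have "ract X (ract X x (h c)) (h b) = ract X x (h (amult A c b))" if "b \<in> vcarrier A" for b
      using that c x by (simp add: h_mult bimodule_mult_ract[OF M] h_carrier)
    note rr = this
    show "vnorm X (ract X (ract X x (h c)) (h a)) \<le> vnorm A c * pnorm x * vnorm A a"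
      using pnorm_ract[OF x banach_algebra_mult[OF A c a]] sub[OF a] rr[OF a] by simp
    fix b assume b: "b \<in> vcarrier A"
    show "vnorm X (lact X (h a) (ract X (ract X x (h c)) (h b)))
        \<le> vnorm A c * pnorm x * (vnorm A a * vnorm A b)"
      using pnorm_lact_ract[OF x a banach_algebra_mult[OF A c b]]
        mult_right_mono[OF sub[OF b] norm_A[OF a]] rr[OF b] by (simp add: mult_ac)
  qed
qed

lemma pullback_bimodule: "banach_bimodule A pullback"
proof -
  have "cbanach pullback"
    by (rule cbanach_renorm[OF X, where L = "K\<^sup>2"])
      (simp_all add: pullback_def pnorm_lower pnorm_upper pnorm_triangle pnorm_smul)
  then show ?thesis
    unfolding banach_bimodule_def
    by (simp add: pullback_simps h_carrier h_plus h_smul h_mult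
        bimodule_lact[OF M] bimodule_ract[OF M]
        bimodule_lact_plus[OF M] bimodule_ract_plus[OF M]
        bimodule_plus_lact[OF M] bimodule_plus_ract[OF M]
        bimodule_smul_lact[OF M] bimodule_lact_smul[OF M]
        bimodule_smul_ract[OF M] bimodule_ract_smul[OF M]
        bimodule_mult_lact[OF M] bimodule_mult_ract[OF M] bimodule_ract_lact[OF M]
        pnorm_contractive_lact pnorm_contractive_ract)
qed

text \<open>Equivalent norms have the same bounded functionals, so the functionals obtained for the
  renormed module already live on \<open>X\<close>.\<close>

lemma dual_pullback: "dual pullback = dual X"
proof -
  have "(\<exists>k. \<forall>x\<in>vcarrier X. cmod (f x) \<le> k * pnorm x) \<longleftrightarrow>
        (\<exists>k. \<forall>x\<in>vcarrier X. cmod (f x) \<le> k * vnorm X x)" for f :: "'x \<Rightarrow> complex"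
  proof (intro iffI; elim exE)
    fix k assume k: "\<forall>x\<in>vcarrier X. cmod (f x) \<le> k * pnorm x"
    have "cmod (f x) \<le> (\<bar>k\<bar> * K\<^sup>2) * vnorm X x" if x: "x \<in> vcarrier X" for x
    proof -
      have "cmod (f x) \<le> \<bar>k\<bar> * pnorm x"
        using k x pnorm_nonneg[OF x] by (meson abs_ge_self mult_right_mono order_trans)
      also have "\<dots> \<le> \<bar>k\<bar> * (K\<^sup>2 * vnorm X x)"
        using pnorm_upper[OF x] by (intro mult_left_mono) auto
      finally show ?thesis by (simp add: mult.assoc)
    qed
    then show "\<exists>k. \<forall>x\<in>vcarrier X. cmod (f x) \<le> k * vnorm X x" by blast
  next
    fix k assume k: "\<forall>x\<in>vcarrier X. cmod (f x) \<le> k * vnorm X x"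
    have "cmod (f x) \<le> \<bar>k\<bar> * pnorm x" if x: "x \<in> vcarrier X" for x
    proof -
      have "cmod (f x) \<le> \<bar>k\<bar> * vnorm X x"
        using k x cbanach_norm_ge_0[OF X x] by (meson abs_ge_self mult_right_mono order_trans)
      also have "\<dots> \<le> \<bar>k\<bar> * pnorm x"
        using pnorm_lower[OF x] by (intro mult_left_mono) auto
      finally show ?thesis .
    qed
    then show "\<exists>k. \<forall>x\<in>vcarrier X. cmod (f x) \<le> k * pnorm x" by blast
  qed
  then show ?thesis unfolding dual_def pullback_simps by simp
qed

lemma pullback_derivation:
  assumes D: "cont_derivation C X D"
  shows "cont_derivation A pullback (\<lambda>a. D (h a))"
proof -
  note d = D[unfolded cont_derivation_def]
  have dual: "D c \<in> dual X" if "c \<in> vcarrier C" for c using d that by blast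
  obtain k where k: "\<And>c. c \<in> vcarrier C \<Longrightarrow> dnorm X (D c) \<le> k * vnorm C c"
    using d by blast
  have "dnorm pullback (D (h a)) \<le> (\<bar>k\<bar> * K) * vnorm A a" if a: "a \<in> vcarrier A" for a
  proof (rule dnorm_le[OF bimodule_cbanach[OF pullback_bimodule]])
    show "\<bar>k\<bar> * K * vnorm A a \<ge> 0" using norm_A[OF a] K_ge_1 by simp
    fix x assume "x \<in> vcarrier pullback"
    then have x: "x \<in> vcarrier X" by (simp add: pullback_simps)
    have "dnorm X (D (h a)) \<le> (\<bar>k\<bar> * K) * vnorm A a"
      using k[OF h_carrier[OF a]] mult_right_mono[OF abs_ge_self[of k] h_norm_nonneg[OF a]]
        mult_left_mono[OF h_bound[OF a] abs_ge_zero[of k]] by (simp add: mult.assoc)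
    then have "dnorm X (D (h a)) * vnorm X x \<le> (\<bar>k\<bar> * K) * vnorm A a * pnorm x"
      using pnorm_lower[OF x] cbanach_norm_ge_0[OF X x] \<open>\<bar>k\<bar> * K * vnorm A a \<ge> 0\<close>
      by (intro mult_mono) auto
    then show "cmod (D (h a) x) \<le> \<bar>k\<bar> * K * vnorm A a * vnorm pullback x"
      using dnorm_bound[OF X dual[OF h_carrier[OF a]] x] by (simp add: pullback_simps)
  qed
  then have bd: "\<exists>L. \<forall>a\<in>vcarrier A. dnorm pullback (D (h a)) \<le> L * vnorm A a" by blast
  have "D (h (vplus A a b)) = (\<lambda>x. D (h a) x + D (h b) x)"
    if "a \<in> vcarrier A" "b \<in> vcarrier A" for a b
    using d h_carrier that by (simp add: h_plus)
  moreover have "D (h (vsmul A z a)) = (\<lambda>x. z * D (h a) x)" if "a \<in> vcarrier A" for z a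
    using d h_carrier that by (simp add: h_smul)
  moreover have "D (h (amult A a b)) =
      (\<lambda>x. dlact pullback a (D (h b)) x + dract pullback (D (h a)) b x)"
    if "a \<in> vcarrier A" "b \<in> vcarrier A" for a b
    using d h_carrier that by (simp add: h_mult) (simp add: dlact_def dract_def pullback_simps cong: if_cong)
  ultimately show ?thesis
    unfolding cont_derivation_def dual_pullback using bd dual h_carrier by blast
qed

lemma pullback_approx_semi_inner:
  assumes amen: "approx_semi_amenable TYPE('x) A" and D: "cont_derivation C X D"
    and Phi: "finite \<Phi>" "\<Phi> \<subseteq> vcarrier A" and e: "e > 0"
  obtains \<xi> \<eta> where "\<xi> \<in> dual X" "\<eta> \<in> dual X"
    "\<And>a x. a \<in> \<Phi> \<Longrightarrow> x \<in> vcarrier X \<Longrightarrow>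
        cmod (D (h a) x - (\<xi> (ract X x (h a)) - \<eta> (lact X (h a) x))) \<le> e * vnorm X x"
proof -
  note D' = pullback_derivation[OF D]
  have "approx_semi_inner A pullback (\<lambda>a. D (h a))"
    using amen pullback_bimodule D' unfolding approx_semi_amenable_def by blast
  moreover have "D (h a) \<in> dual pullback" if "a \<in> vcarrier A" for a
    using D' that unfolding cont_derivation_def by blast
  \<comment> \<open>The error will be measured by \<open>pnorm\<close>, which is at most
    \<open>K\<^sup>2\<close> times the original norm.\<close>
  moreover have "e / K\<^sup>2 > 0" using e K_ge_1 by simp
  ultimately obtain \<xi> \<eta> where p: "\<xi> \<in> dual pullback" "\<eta> \<in> dual pullback"
    "\<And>a x. a \<in> \<Phi> \<Longrightarrow> x \<in> vcarrier pullback \<Longrightarrow>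
        cmod (D (h a) x - (\<xi> (ract pullback x a) - \<eta> (lact pullback a x)))
        \<le> e / K\<^sup>2 * vnorm pullback x"
    using approx_semi_innerD[OF pullback_bimodule _ _ Phi] by metis
  show ?thesis
  proof (rule that)
    show "\<xi> \<in> dual X" "\<eta> \<in> dual X" using p(1,2) dual_pullback by auto
    fix a x assume a: "a \<in> \<Phi>" and x: "x \<in> vcarrier X"
    have "cmod (D (h a) x - (\<xi> (ract X x (h a)) - \<eta> (lact X (h a) x))) \<le> e / K\<^sup>2 * pnorm x"
      using p(3)[OF a, of x] x by (simp add: pullback_simps)
    also have "\<dots> \<le> e / K\<^sup>2 * (K\<^sup>2 * vnorm X x)"
      using pnorm_upper[OF x] e by (intro mult_left_mono) auto
    also have "\<dots> = e * vnorm X x" using K_ge_1 by simp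
    finally show "cmod (D (h a) x - (\<xi> (ract X x (h a)) - \<eta> (lact X (h a) x))) \<le> e * vnorm X x" .
  qed
qed

end

section \<open>Finitely supported elements of a Banach function algebra\<close>

text \<open>In a function algebra such an \<open>e\<close> is the indicator of a set on which every
  element of \<open>B\<close> is constant, and \<open>b \<mapsto> b s\<close> is the corresponding
  character. \<open>B\<close> need not separate points, so indicators of single points may be
  missing from it.\<close>

definition atom :: "('s \<Rightarrow> complex) calg \<Rightarrow> ('s \<Rightarrow> complex) \<Rightarrow> bool" where
  "atom B e \<longleftrightarrow> e \<in> vcarrier B \<and> e \<noteq> vzero B \<and> amult B e e = e \<and>
     (\<exists>s. \<forall>b\<in>vcarrier B. amult B e b = vsmul B (b s) e)"

lemma
  assumes "banach_function_algebra S B"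
  shows function_algebra_banach: "banach_algebra B"
    and function_algebra_outside: "\<And>f s. f \<in> vcarrier B \<Longrightarrow> s \<notin> S \<Longrightarrow> f s = 0"
    and function_algebra_zero: "vzero B = (\<lambda>s. 0)"
    and function_algebra_plus: "\<And>f g. f \<in> vcarrier B \<Longrightarrow> g \<in> vcarrier B \<Longrightarrow> vplus B f g = (\<lambda>s. f s + g s)"
    and function_algebra_smul: "\<And>a f. f \<in> vcarrier B \<Longrightarrow> vsmul B a f = (\<lambda>s. a * f s)"
    and function_algebra_mult: "\<And>f g. f \<in> vcarrier B \<Longrightarrow> g \<in> vcarrier B \<Longrightarrow> amult B f g = (\<lambda>s. f s * g s)"
  using assms unfolding banach_function_algebra_def by - (elim conjE, simp)+

lemma function_algebra_minus_smul:
  assumes FA: "banach_function_algebra S B" and f: "f \<in> vcarrier B" and g: "g \<in> vcarrier B"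
  shows "(\<lambda>s. f s - z * g s) \<in> vcarrier B"
proof -
  note B = banach_algebra_cbanach[OF function_algebra_banach[OF FA]]
  have "vplus B f (vsmul B (- z) g) \<in> vcarrier B"
    using f g by (intro cbanach_plus[OF B] cbanach_smul[OF B])
  then show ?thesis
    using f g cbanach_smul[OF B g, of "-z"]
    by (simp add: function_algebra_plus[OF FA] function_algebra_smul[OF FA])
qed

text \<open>A nonzero element \<open>g\<close> of minimal support is, up to a scalar, an atom: for \<open>s\<close> in its
  support, \<open>g b - b(s) g\<close> has strictly smaller support and hence vanishes.\<close>
lemma atom_exists:
  assumes FA: "banach_function_algebra S B" and u: "u \<in> vcarrier B" "u \<noteq> (\<lambda>s. 0)"
    and fin: "finite {s. u s \<noteq> 0}"
  obtains e s where "atom B e" "e s = 1" "u s \<noteq> 0" "\<And>t. e t = 0 \<or> e t = 1"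
    "amult B e u = vsmul B (u s) e"
proof -
  note B = banach_algebra_cbanach[OF function_algebra_banach[OF FA]]
  \<comment> \<open>Minimising only inside the support of \<open>u\<close> keeps the cardinalities
    meaningful and forces the point \<open>s\<close> found below to satisfy
    \<open>u s \<noteq> 0\<close>.\<close>
  let ?P = "\<lambda>g. g \<in> vcarrier B \<and> g \<noteq> (\<lambda>s. 0) \<and> {s. g s \<noteq> 0} \<subseteq> {s. u s \<noteq> 0}"
  obtain g where g: "?P g" and min: "\<And>f. ?P f \<Longrightarrow> card {s. g s \<noteq> 0} \<le> card {s. f s \<noteq> 0}"
    using arg_min_nat_lemma[of ?P u "\<lambda>g. card {s. g s \<noteq> 0}"] u by blast
  then obtain s where s: "g s \<noteq> 0" by (meson ext)
  have gB: "g \<in> vcarrier B" using g by blast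
  have fing: "finite {s. g s \<noteq> 0}" using g fin finite_subset by blast
  have eig: "g t * b t = b s * g t" if b: "b \<in> vcarrier B" for b t
  proof -
    let ?f = "\<lambda>t. amult B g b t - b s * g t"
    have m: "amult B g b = (\<lambda>t. g t * b t)" using function_algebra_mult[OF FA gB b] .
    have "?f \<in> vcarrier B"
      by (rule function_algebra_minus_smul[OF FA banach_algebra_mult[OF function_algebra_banach[OF FA] gB b] gB])
    moreover have "{t. ?f t \<noteq> 0} \<subset> {t. g t \<noteq> 0}" using s by (auto simp: m)
    moreover from this have "card {t. ?f t \<noteq> 0} < card {t. g t \<noteq> 0}"
      using fing by (rule psubset_card_mono[rotated])
    ultimately have "?f = (\<lambda>t. 0)" using min[of ?f] g by fastforce
    then show ?thesis by (simp add: m fun_eq_iff)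
  qed
  define e where "e = vsmul B (inverse (g s)) g"
  have e: "e = (\<lambda>t. inverse (g s) * g t)" unfolding e_def using function_algebra_smul[OF FA gB] .
  have eB: "e \<in> vcarrier B" unfolding e_def using cbanach_smul[OF B gB] .
  have mult: "amult B e b = vsmul B (b s) e" if b: "b \<in> vcarrier B" for b
    unfolding function_algebra_mult[OF FA eB b] function_algebra_smul[OF FA eB]
    using eig[OF b] by (auto simp: e fun_eq_iff)
  have es: "e s = 1" using s by (simp add: e)
  have idem: "amult B e e = e" using mult[OF eB] es by (simp add: cbanach_smul_one[OF B eB])
  have "e t = 0 \<or> e t = 1" for t
    using fun_cong[OF idem, of t] by (simp add: function_algebra_mult[OF FA eB eB])
  moreover have "atom B e"
    unfolding atom_def function_algebra_zero[OF FA] using eB idem mult es by fastforce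
  moreover have "u s \<noteq> 0" using g s by blast
  ultimately show ?thesis using that es mult[OF u(1)] by blast
qed

text \<open>From \<open>e u = u(s) e\<close> it follows that \<open>u\<close> has the constant value
  \<open>u s\<close> where \<open>e\<close> is 1. Subtracting \<open>u(s) e\<close> therefore erases
  \<open>u\<close> there and leaves it unchanged elsewhere, so the support shrinks strictly.\<close>

lemma finite_support_induct [consumes 3, case_names zero add]:
  assumes FA: "banach_function_algebra S B" and "u \<in> vcarrier B" and "finite_support S u"
    and zero: "P (vzero B)"
    and add: "\<And>v e z. v \<in> vcarrier B \<Longrightarrow> atom B e \<Longrightarrow> P v \<Longrightarrow> P (vplus B v (vsmul B z e))"
  shows "P u"
proof -
  note B = banach_algebra_cbanach[OF function_algebra_banach[OF FA]]
  \<comment> \<open>\<open>finite_support\<close> counts points of \<open>S\<close> only; elements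
    of \<open>B\<close> vanish outside \<open>S\<close>, so the whole support is finite.\<close>
  have "{s. u s \<noteq> 0} = {s\<in>S. u s \<noteq> 0}"
    using function_algebra_outside[OF FA \<open>u \<in> vcarrier B\<close>] by blast
  then have "finite {s. u s \<noteq> 0}"
    using \<open>finite_support S u\<close> unfolding finite_support_def by simp
  then show ?thesis using \<open>u \<in> vcarrier B\<close>
  proof (induction "card {s. u s \<noteq> 0}" arbitrary: u rule: less_induct)
    case less
    show ?case
    proof (cases "u = (\<lambda>s. 0)")
      case True
      then show ?thesis using zero function_algebra_zero[OF FA] by simp
    next
      case False
      obtain e s where e: "atom B e" "e s = 1" "u s \<noteq> 0" "\<And>t. e t = 0 \<or> e t = 1"
        "amult B e u = vsmul B (u s) e"
        using atom_exists[OF FA less.prems(2) False less.prems(1)] by metis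
      have eB: "e \<in> vcarrier B" using e(1) unfolding atom_def by blast
      have ut: "u t = u s" if "e t = 1" for t
        using fun_cong[OF e(5), of t] that less.prems(2) eB
        by (simp add: function_algebra_mult[OF FA] function_algebra_smul[OF FA])
      let ?v = "\<lambda>t. u t - u s * e t"
      have v: "?v \<in> vcarrier B" using function_algebra_minus_smul[OF FA less.prems(2) eB] .
      have sub: "{t. ?v t \<noteq> 0} \<subset> {t. u t \<noteq> 0}"
      proof -
        \<comment> \<open>If \<open>e t\<close> were 1, then \<open>u t = u s\<close> would be
          nonzero; hence \<open>e t = 0\<close>, and no new support point arises.\<close>
        have "?v t = 0" if "u t = 0" for t
          using e(4)[of t] ut[of t] that e(3) by auto
        moreover have "?v s = 0" using e(2) by simp
        ultimately show ?thesis using e(3) by blast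
      qed
      have "P ?v"
      proof (rule less.hyps)
        show "card {t. ?v t \<noteq> 0} < card {t. u t \<noteq> 0}"
          using sub less.prems(1) by (rule psubset_card_mono[rotated])
        show "finite {t. ?v t \<noteq> 0}" using sub less.prems(1) finite_subset by blast
      qed (rule v)
      then have "P (vplus B ?v (vsmul B (u s) e))" by (rule add[OF v e(1)])
      moreover have "vplus B ?v (vsmul B (u s) e) = u"
        using function_algebra_plus[OF FA v cbanach_smul[OF B eB, of "u s"]]
          function_algebra_smul[OF FA eB] by simp
      ultimately show ?thesis by simp
    qed
  qed
qed

section \<open>The projective tensor product\<close>

lemma dual_minus:
  "cbanach X \<Longrightarrow> f \<in> dual X \<Longrightarrow> x \<in> vcarrier X \<Longrightarrow> y \<in> vcarrier X \<Longrightarrow> f (vminus X x y) = f x - f y"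
  by (simp add: vminus_def dual_plus dual_smul cbanach_smul)

lemma cbanach_norm_minus_commute:
  assumes V: "cbanach V" and x: "x \<in> vcarrier V" and y: "y \<in> vcarrier V"
  shows "vnorm V (vminus V x y) = vnorm V (vminus V y x)"
proof -
  have "vsmul V (-1) (vminus V x y) = vplus V (vsmul V (-1) x) y"
    unfolding vminus_def using x y
    by (simp add: cbanach_smul_plus[OF V] cbanach_smul[OF V] cbanach_smul_smul[OF V] cbanach_smul_one[OF V])
  also have "\<dots> = vminus V y x"
    unfolding vminus_def using cbanach_commute[OF V cbanach_smul[OF V x] y] .
  finally show ?thesis
    using cbanach_norm_smul[OF V cbanach_minus[OF V x y], of "-1"] by simp
qed

text \<open>Tensors are realised as functionals on bilinear forms, so the sum is recorded through
  what bounded functionals see of it.\<close>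

lemma absolutely_convergent_sum:
  assumes V: "cbanach V" and x: "\<And>n. x n \<in> vcarrier V" and summ: "summable (\<lambda>n. vnorm V (x n))"
  obtains s where "s \<in> vcarrier V" "\<And>f. f \<in> dual V \<Longrightarrow> (\<lambda>n. f (x n)) sums f s"
proof -
  \<comment> \<open>The addition is a record field, so the partial sums are built by
    recursion.\<close>
  define p where "p = rec_nat (vzero V) (\<lambda>n y. vplus V y (x n))"
  have p0: "p 0 = vzero V" and pS: "p (Suc n) = vplus V (p n) (x n)" for n
    by (simp_all add: p_def)
  have p: "p n \<in> vcarrier V" for n
    by (induction n) (simp_all add: p0 pS cbanach_zero[OF V] cbanach_plus[OF V] x)
  have inc: "vnorm V (vminus V (p (m + k)) (p m)) \<le> (\<Sum>i\<in>{m..<m + k}. vnorm V (x i))" for m k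
  proof (induction k)
    case 0
    show ?case by (simp add: vminus_def cbanach_right_inverse[OF V p] cbanach_norm_zero[OF V])
  next
    case (Suc k)
    have "vminus V (p (m + Suc k)) (p m) = vplus V (vminus V (p (m + k)) (p m)) (x (m + k))"
      unfolding vminus_def
      using p[of m] p[of "m+k"] x[of "m+k"] cbanach_smul[OF V p[of m], of "-1"]
      by (simp add: pS cbanach_assoc[OF V] cbanach_commute[OF V])
    then have "vnorm V (vminus V (p (m + Suc k)) (p m))
        \<le> vnorm V (vminus V (p (m + k)) (p m)) + vnorm V (x (m + k))"
      using cbanach_norm_triangle[OF V cbanach_minus[OF V p p] x] by simp
    then show ?case using Suc by simp
  qed
  have "\<exists>N. \<forall>m\<ge>N. \<forall>n\<ge>N. vnorm V (vminus V (p m) (p n)) < e" if e: "e > 0" for e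
  proof -
    obtain N where N: "\<And>m n. m \<ge> N \<Longrightarrow> norm (\<Sum>i\<in>{m..<n}. vnorm V (x i)) < e"
      using summ e unfolding summable_Cauchy by blast
    have le: "vnorm V (vminus V (p n) (p m)) < e" if "m \<ge> N" "n \<ge> m" for m n
      using inc[of m "n - m"] N[OF that(1), of n] that by (auto simp: abs_less_iff)
    have "vnorm V (vminus V (p m) (p n)) < e" if "m \<ge> N" "n \<ge> N" for m n
      using le[of m n] le[of n m] that cbanach_norm_minus_commute[OF V p p, of m n]
      by (cases "n \<ge> m") auto
    then show ?thesis by blast
  qed
  from cbanach_complete[OF V p this] obtain s
    where s: "s \<in> vcarrier V" "(\<lambda>n. vnorm V (vminus V (p n) s)) \<longlonglongrightarrow> 0" .
  show ?thesis
  proof (rule that[OF s(1)])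
    fix f assume f: "f \<in> dual V"
    obtain K where K: "\<And>x. x \<in> vcarrier V \<Longrightarrow> cmod (f x) \<le> K * vnorm V x"
      using dual_bound_nonneg[OF V f] by metis
    have "vsmul V 0 (vzero V) = vzero V"
      using cbanach_norm_smul[OF V cbanach_zero[OF V], of 0]
      by (simp add: cbanach_norm_eq_0[OF V cbanach_smul[OF V cbanach_zero[OF V]]])
    then have f0: "f (vzero V) = 0" using dual_smul[OF f cbanach_zero[OF V], of 0] by simp
    have fp: "f (p n) = (\<Sum>i<n. f (x i))" for n
      by (induction n) (simp_all add: p0 pS f0 dual_plus[OF f p x])
    have "(\<lambda>n. f (p n) - f s) \<longlonglongrightarrow> 0"
    proof (rule Lim_null_comparison)
      show "\<forall>\<^sub>F n in sequentially. norm (f (p n) - f s) \<le> K * vnorm V (vminus V (p n) s)"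
        using K[OF cbanach_minus[OF V p s(1)]] by (simp add: dual_minus[OF V f p s(1)])
      show "(\<lambda>n. K * vnorm V (vminus V (p n) s)) \<longlonglongrightarrow> 0"
        using tendsto_mult_left[OF s(2), of K] by simp
    qed
    then show "(\<lambda>n. f (x n)) sums f s"
      unfolding sums_def fp by (simp add: LIM_zero_iff)
  qed
qed

lemma mbaiD:
  assumes C: "banach_algebra C" and F: "mbai_with P C F"
  obtains M where "F \<noteq> bot" "M \<ge> 0"
    "\<forall>c\<in>vcarrier C. ((\<lambda>u. vnorm C (vminus C (amult C u c) c)) \<longlongrightarrow> 0) F"
    "\<forall>\<^sub>F u in F. u \<in> vcarrier C \<and> P u \<and> (\<forall>c\<in>vcarrier C. vnorm C (amult C u c) \<le> M * vnorm C c)"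
proof -
  obtain M where M: "\<forall>\<^sub>F u in F. \<forall>c\<in>vcarrier C. vnorm C (amult C u c) \<le> M * vnorm C c"
    and F': "F \<noteq> bot" "\<forall>\<^sub>F u in F. u \<in> vcarrier C \<and> P u"
      "\<forall>c\<in>vcarrier C. ((\<lambda>u. vnorm C (vminus C (amult C u c) c)) \<longlongrightarrow> 0) F"
    using F unfolding mbai_with_def by blast
  have le: "M * vnorm C c \<le> \<bar>M\<bar> * vnorm C c" if "c \<in> vcarrier C" for c
    using cbanach_norm_ge_0[OF banach_algebra_cbanach[OF C] that] by (intro mult_right_mono) auto
  from eventually_conj[OF F'(2) M] have "\<forall>\<^sub>F u in F. u \<in> vcarrier C \<and> P u \<and>
      (\<forall>c\<in>vcarrier C. vnorm C (amult C u c) \<le> \<bar>M\<bar> * vnorm C c)"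
    by (rule eventually_mono) (use order_trans[OF _ le] in blast)
  with F'(1) abs_ge_zero F'(3) show ?thesis by (rule that)
qed

lemma amult_zero_right:
  assumes C: "banach_algebra C" and v: "v \<in> vcarrier C"
  shows "amult C v (vzero C) = vzero C"
proof -
  note cb = banach_algebra_cbanach[OF C]
  have "vnorm C (amult C v (vzero C)) = 0"
    using banach_algebra_norm_mult[OF C v cbanach_zero[OF cb]]
      cbanach_norm_ge_0[OF cb banach_algebra_mult[OF C v cbanach_zero[OF cb]]]
    by (simp add: cbanach_norm_zero[OF cb])
  then show ?thesis
    by (simp only: cbanach_norm_eq_0[OF cb banach_algebra_mult[OF C v cbanach_zero[OF cb]]])
qed

text \<open>Places two infinite sequences on the even and the odd indices, so that the sum of two
  tensors is again given by one representing sequence.\<close>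

definition interleave :: "(nat \<Rightarrow> 'a) \<Rightarrow> (nat \<Rightarrow> 'a) \<Rightarrow> nat \<Rightarrow> 'a" where
  "interleave f g n = (if even n then f (n div 2) else g ((n - 1) div 2))"

lemma sums_interleave_real:
  fixes f g :: "nat \<Rightarrow> real"
  assumes "f sums x" "g sums y"
  shows "interleave f g sums (x + y)"
  using sums_if[OF assms(2,1)] by (simp add: interleave_def[abs_def] add.commute)

lemma sums_interleave_complex:
  fixes f g :: "nat \<Rightarrow> complex"
  assumes "f sums x" "g sums y"
  shows "interleave f g sums (x + y)"
  using sums_interleave_real[of "\<lambda>n. Re (f n)" "Re x" "\<lambda>n. Re (g n)" "Re y"]
    sums_interleave_real[of "\<lambda>n. Im (f n)" "Im x" "\<lambda>n. Im (g n)" "Im y"] assms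
  by (simp add: sums_complex_iff interleave_def[abs_def] if_distrib cong: if_cong)

locale algebra_pair =
  fixes A :: "'a calg" and B :: "'b calg"
  assumes A: "banach_algebra A" and B: "banach_algebra B"
begin

lemmas cA = banach_algebra_cbanach[OF A]
lemmas cB = banach_algebra_cbanach[OF B]

abbreviation T where "T \<equiv> ptensor A B"

section \<open>Bounded bilinear forms and representing series\<close>

lemma ptensor_simps:
  "vcarrier T = {tens_of A B a b | a b. tensor_rep A B a b}"
  "vplus T \<Phi> \<Psi> = (\<lambda>\<phi>. \<Phi> \<phi> + \<Psi> \<phi>)"
  "vsmul T z \<Phi> = (\<lambda>\<phi>. z * \<Phi> \<phi>)"
  "amult T \<Phi> \<Psi> = (\<lambda>\<phi>. if bilform A B \<phi>
                 then \<Phi> (\<lambda>x y. \<Psi> (\<lambda>x' y'. \<phi> (amult A x x') (amult B y y'))) else 0)"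
  by (simp_all add: ptensor_def)

lemma bilform_right: "bilform A B \<phi> \<Longrightarrow> a \<in> vcarrier A \<Longrightarrow> b \<in> vcarrier B \<Longrightarrow> b' \<in> vcarrier B \<Longrightarrow>
    \<phi> a (vplus B b b') = \<phi> a b + \<phi> a b'"
  and bilform_left: "bilform A B \<phi> \<Longrightarrow> a \<in> vcarrier A \<Longrightarrow> a' \<in> vcarrier A \<Longrightarrow> b \<in> vcarrier B \<Longrightarrow>
    \<phi> (vplus A a a') b = \<phi> a b + \<phi> a' b"
  and bilform_smul_left: "bilform A B \<phi> \<Longrightarrow> a \<in> vcarrier A \<Longrightarrow> b \<in> vcarrier B \<Longrightarrow>
    \<phi> (vsmul A z a) b = z * \<phi> a b"
  and bilform_smul_right: "bilform A B \<phi> \<Longrightarrow> a \<in> vcarrier A \<Longrightarrow> b \<in> vcarrier B \<Longrightarrow>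
    \<phi> a (vsmul B z b) = z * \<phi> a b"
  unfolding bilform_def by blast+

lemma norm_A: "a \<in> vcarrier A \<Longrightarrow> 0 \<le> vnorm A a"
  and norm_B: "b \<in> vcarrier B \<Longrightarrow> 0 \<le> vnorm B b"
  using cbanach_norm_ge_0[OF cA] cbanach_norm_ge_0[OF cB] by auto

lemma bilform_bound:
  assumes "bilform A B \<phi>"
  obtains K where "K \<ge> 0" "\<And>a b. a \<in> vcarrier A \<Longrightarrow> b \<in> vcarrier B \<Longrightarrow>
    cmod (\<phi> a b) \<le> K * (vnorm A a * vnorm B b)"
proof -
  obtain K where K: "\<And>a b. a \<in> vcarrier A \<Longrightarrow> b \<in> vcarrier B \<Longrightarrow>
      cmod (\<phi> a b) \<le> K * vnorm A a * vnorm B b"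
    using assms unfolding bilform_def by blast
  have "cmod (\<phi> a b) \<le> \<bar>K\<bar> * (vnorm A a * vnorm B b)" if "a \<in> vcarrier A" "b \<in> vcarrier B" for a b
  proof -
    have "K * (vnorm A a * vnorm B b) \<le> \<bar>K\<bar> * (vnorm A a * vnorm B b)"
      using norm_A[OF that(1)] norm_B[OF that(2)] by (intro mult_right_mono) auto
    then show ?thesis using K[OF that] by (simp add: mult.assoc)
  qed
  then show ?thesis using that[of "\<bar>K\<bar>"] by simp
qed

lemma bilformI:
  assumes "\<And>a b b'. a \<in> vcarrier A \<Longrightarrow> b \<in> vcarrier B \<Longrightarrow> b' \<in> vcarrier B \<Longrightarrow>
      \<phi> a (vplus B b b') = \<phi> a b + \<phi> a b'"
    and "\<And>a a' b. a \<in> vcarrier A \<Longrightarrow> a' \<in> vcarrier A \<Longrightarrow> b \<in> vcarrier B \<Longrightarrow>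
      \<phi> (vplus A a a') b = \<phi> a b + \<phi> a' b"
    and "\<And>z a b. a \<in> vcarrier A \<Longrightarrow> b \<in> vcarrier B \<Longrightarrow> \<phi> (vsmul A z a) b = z * \<phi> a b"
    and "\<And>z a b. a \<in> vcarrier A \<Longrightarrow> b \<in> vcarrier B \<Longrightarrow> \<phi> a (vsmul B z b) = z * \<phi> a b"
    and "\<And>a b. a \<in> vcarrier A \<Longrightarrow> b \<in> vcarrier B \<Longrightarrow> cmod (\<phi> a b) \<le> K * (vnorm A a * vnorm B b)"
  shows "bilform A B \<phi>"
  unfolding bilform_def
proof (intro conjI)
  show "\<exists>K. \<forall>a\<in>vcarrier A. \<forall>b\<in>vcarrier B. cmod (\<phi> a b) \<le> K * vnorm A a * vnorm B b"
    using assms(5) by (intro exI[of _ K]) (simp add: mult.assoc)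
qed (use assms(1-4) in blast)+

lemma bilform_zero:
  assumes "bilform A B \<phi>"
  shows "\<phi> (vzero A) (vzero B) = 0"
proof -
  obtain K where "cmod (\<phi> (vzero A) (vzero B)) \<le> K * (vnorm A (vzero A) * vnorm B (vzero B))"
    using bilform_bound[OF assms] cbanach_zero[OF cA] cbanach_zero[OF cB] by metis
  then show ?thesis by (simp add: cbanach_norm_zero[OF cA])
qed

lemma tensor_rep_carrier:
  "tensor_rep A B a b \<Longrightarrow> a n \<in> vcarrier A" "tensor_rep A B a b \<Longrightarrow> b n \<in> vcarrier B"
  by (simp_all add: tensor_rep_def)

lemma tensor_rep_summable: "tensor_rep A B a b \<Longrightarrow> summable (\<lambda>n. vnorm A (a n) * vnorm B (b n))"
  by (simp add: tensor_rep_def)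

lemma tensor_rep_dominated:
  assumes ab: "tensor_rep A B a b"
    and "\<And>n. a' n \<in> vcarrier A" "\<And>n. b' n \<in> vcarrier B"
    and le: "\<And>n. vnorm A (a' n) * vnorm B (b' n) \<le> L * (vnorm A (a n) * vnorm B (b n))"
  shows "tensor_rep A B a' b'"
  unfolding tensor_rep_def
proof (intro conjI allI assms(2,3))
  show "summable (\<lambda>n. vnorm A (a' n) * vnorm B (b' n))"
    using le norm_A[OF assms(2)] norm_B[OF assms(3)]
    by (intro summable_comparison_test'[OF summable_mult[OF tensor_rep_summable[OF ab], of L], of 0]) simp
qed

lemma bilform_summable:
  assumes ab: "tensor_rep A B a b" and \<phi>: "bilform A B \<phi>"
  shows "summable (\<lambda>n. \<phi> (a n) (b n))"
proof -
  obtain K where K: "\<And>a b. a \<in> vcarrier A \<Longrightarrow> b \<in> vcarrier B \<Longrightarrow>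
      cmod (\<phi> a b) \<le> K * (vnorm A a * vnorm B b)"
    using bilform_bound[OF \<phi>] by metis
  show ?thesis
    using K tensor_rep_carrier[OF ab]
    by (intro summable_comparison_test'[OF summable_mult[OF tensor_rep_summable[OF ab], of K], of 0]) simp
qed

lemma tensor_norm_mult_le:
  assumes ab: "tensor_rep A B a b" and v: "v \<in> vcarrier A" and u: "u \<in> vcarrier B"
  shows "vnorm A (amult A v (a n)) * vnorm B (amult B u (b n))
      \<le> vnorm A v * vnorm B u * (vnorm A (a n) * vnorm B (b n))"
proof -
  have "vnorm A (amult A v (a n)) * vnorm B (amult B u (b n))
      \<le> (vnorm A v * vnorm A (a n)) * (vnorm B u * vnorm B (b n))"
    using tensor_rep_carrier[OF ab, of n] v u
    by (intro mult_mono banach_algebra_norm_mult[OF A] banach_algebra_norm_mult[OF B]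
        mult_nonneg_nonneg norm_A norm_B banach_algebra_mult[OF B])
  then show ?thesis by (simp add: mult_ac)
qed

lemma tensor_rep_mult:
  assumes ab: "tensor_rep A B a b" and v: "v \<in> vcarrier A" and u: "u \<in> vcarrier B"
  shows "tensor_rep A B (\<lambda>n. amult A v (a n)) (\<lambda>n. amult B u (b n))"
  by (rule tensor_rep_dominated[OF ab _ _ tensor_norm_mult_le[OF ab v u]])
    (use tensor_rep_carrier[OF ab] v u in \<open>auto intro: banach_algebra_mult[OF A] banach_algebra_mult[OF B]\<close>)

lemma tens_of_in_carrier: "tensor_rep A B a b \<Longrightarrow> tens_of A B a b \<in> vcarrier T"
  unfolding ptensor_simps by blast

lemma ptensor_norm_le:
  assumes "tensor_rep A B a b"
  shows "vnorm T (tens_of A B a b) \<le> (\<Sum>n. vnorm A (a n) * vnorm B (b n))"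
proof -
  have "bdd_below {(\<Sum>n. vnorm A (a' n) * vnorm B (b' n)) | a' b'.
      tensor_rep A B a' b' \<and> tens_of A B a b = tens_of A B a' b'}"
    by (rule bdd_belowI[of _ 0])
      (auto intro!: suminf_nonneg tensor_rep_summable mult_nonneg_nonneg norm_A norm_B
        simp: tensor_rep_carrier)
  then show ?thesis
    unfolding ptensor_def using assms by (auto intro!: cInf_lower)
qed

lemma ptensor_norm_nonneg:
  assumes "\<Phi> \<in> vcarrier T"
  shows "vnorm T \<Phi> \<ge> 0"
proof -
  have "0 \<le> Inf {(\<Sum>n. vnorm A (a n) * vnorm B (b n)) | a b.
      tensor_rep A B a b \<and> \<Phi> = tens_of A B a b}"
    using assms unfolding ptensor_simps
    by (intro cInf_greatest)
      (auto intro!: suminf_nonneg tensor_rep_summable mult_nonneg_nonneg norm_A norm_B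
        simp: tensor_rep_carrier)
  then show ?thesis by (simp add: ptensor_def)
qed

section \<open>Elementary tensors\<close>

definition etens :: "'a \<Rightarrow> 'b \<Rightarrow> ('a \<Rightarrow> 'b \<Rightarrow> complex) \<Rightarrow> complex" where
  "etens a b = (\<lambda>\<phi>. if bilform A B \<phi> then \<phi> a b else 0)"

definition single :: "'c \<Rightarrow> 'c \<Rightarrow> nat \<Rightarrow> 'c" where
  "single z a n = (if n = 0 then a else z)"

text \<open>An elementary tensor is the series with one term, padded by pairs of zero vectors. The
  padding contributes neither to the norm sum nor to any bounded bilinear form.\<close>

lemma
  assumes a: "a \<in> vcarrier A" and b: "b \<in> vcarrier B"
  shows tensor_rep_single: "tensor_rep A B (single (vzero A) a) (single (vzero B) b)"
    and sum_norm_single: "(\<Sum>n. vnorm A (single (vzero A) a n) * vnorm B (single (vzero B) b n))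
          = vnorm A a * vnorm B b"
    and etens_eq_tens_of: "etens a b = tens_of A B (single (vzero A) a) (single (vzero B) b)"
proof -
  have "(\<lambda>n. vnorm A (single (vzero A) a n) * vnorm B (single (vzero B) b n))
      = (\<lambda>n. if n = 0 then vnorm A a * vnorm B b else 0)"
    by (auto simp: single_def cbanach_norm_zero[OF cA])
  then have s: "(\<lambda>n. vnorm A (single (vzero A) a n) * vnorm B (single (vzero B) b n))
      sums (vnorm A a * vnorm B b)"
    using sums_single[of 0 "\<lambda>_. vnorm A a * vnorm B b"] by simp
  then show "(\<Sum>n. vnorm A (single (vzero A) a n) * vnorm B (single (vzero B) b n))
      = vnorm A a * vnorm B b"
    by (simp add: sums_iff)
  show "tensor_rep A B (single (vzero A) a) (single (vzero B) b)"
    unfolding tensor_rep_def using s a b cbanach_zero[OF cA] cbanach_zero[OF cB]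
    by (auto simp: sums_iff single_def)
  show "etens a b = tens_of A B (single (vzero A) a) (single (vzero B) b)"
  proof
    fix \<phi>
    have "(\<Sum>n. \<phi> (single (vzero A) a n) (single (vzero B) b n)) = \<phi> a b" if "bilform A B \<phi>"
    proof -
      have "(\<lambda>n. \<phi> (single (vzero A) a n) (single (vzero B) b n)) = (\<lambda>n. if n = 0 then \<phi> a b else 0)"
        by (auto simp: single_def bilform_zero[OF that])
      then show ?thesis
        using sums_single[of 0 "\<lambda>_. \<phi> a b"] by (simp add: sums_iff)
    qed
    then show "etens a b \<phi> = tens_of A B (single (vzero A) a) (single (vzero B) b) \<phi>"
      by (simp add: etens_def tens_of_def)
  qed
qed

lemma etens_in_carrier: "a \<in> vcarrier A \<Longrightarrow> b \<in> vcarrier B \<Longrightarrow> etens a b \<in> vcarrier T"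
  using etens_eq_tens_of tens_of_in_carrier[OF tensor_rep_single] by simp

lemma etens_norm_le: "a \<in> vcarrier A \<Longrightarrow> b \<in> vcarrier B \<Longrightarrow> vnorm T (etens a b) \<le> vnorm A a * vnorm B b"
  using ptensor_norm_le[OF tensor_rep_single] by (simp add: etens_eq_tens_of sum_norm_single)

lemma etens_plus_left: "a \<in> vcarrier A \<Longrightarrow> a' \<in> vcarrier A \<Longrightarrow> b \<in> vcarrier B \<Longrightarrow>
    etens (vplus A a a') b = vplus T (etens a b) (etens a' b)"
  and etens_smul_left: "a \<in> vcarrier A \<Longrightarrow> b \<in> vcarrier B \<Longrightarrow>
    etens (vsmul A z a) b = vsmul T z (etens a b)"
  by (auto simp: etens_def ptensor_simps bilform_left bilform_smul_left)

section \<open>Multiplication by elementary tensors on representing series\<close>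

lemma bilform_mult:
  assumes \<phi>: "bilform A B \<phi>" and x: "x \<in> vcarrier A" and y: "y \<in> vcarrier B"
  shows "bilform A B (\<lambda>x' y'. \<phi> (amult A x x') (amult B y y'))"
    and "bilform A B (\<lambda>x' y'. \<phi> (amult A x' x) (amult B y' y))"
proof -
  obtain K where K: "K \<ge> 0" "\<And>a b. a \<in> vcarrier A \<Longrightarrow> b \<in> vcarrier B \<Longrightarrow>
      cmod (\<phi> a b) \<le> K * (vnorm A a * vnorm B b)"
    using bilform_bound[OF \<phi>] by metis
  note cl = banach_algebra_mult[OF A] banach_algebra_mult[OF B] x y
  note eqs = bilform_left[OF \<phi>] bilform_right[OF \<phi>] bilform_smul_left[OF \<phi>] bilform_smul_right[OF \<phi>]
    banach_algebra_distrib_left[OF A] banach_algebra_distrib_right[OF A]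
    banach_algebra_distrib_left[OF B] banach_algebra_distrib_right[OF B]
    banach_algebra_smul_left[OF A] banach_algebra_smul_right[OF A]
    banach_algebra_smul_left[OF B] banach_algebra_smul_right[OF B]
  have bound: "cmod (\<phi> p q) \<le> (K * (vnorm A x * vnorm B y)) * (vnorm A a * vnorm B b)"
    if "p \<in> vcarrier A" "q \<in> vcarrier B" "a \<in> vcarrier A" "b \<in> vcarrier B"
      "vnorm A p \<le> vnorm A x * vnorm A a" "vnorm B q \<le> vnorm B y * vnorm B b" for p q a b
  proof -
    have "K * (vnorm A p * vnorm B q) \<le> K * ((vnorm A x * vnorm A a) * (vnorm B y * vnorm B b))"
      using that K(1) x by (intro mult_left_mono mult_mono) (auto intro!: mult_nonneg_nonneg norm_A norm_B)
    then show ?thesis using K(2)[OF that(1,2)] by (simp add: mult_ac)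
  qed
  show "bilform A B (\<lambda>x' y'. \<phi> (amult A x x') (amult B y y'))"
    by (rule bilformI; (rule bound)?)
      (simp_all add: cl eqs banach_algebra_norm_mult[OF A] banach_algebra_norm_mult[OF B])
  show "bilform A B (\<lambda>x' y'. \<phi> (amult A x' x) (amult B y' y))"
  proof (rule bilformI; (rule bound)?)
    fix a b assume ab: "a \<in> vcarrier A" "b \<in> vcarrier B"
    show "vnorm A (amult A a x) \<le> vnorm A x * vnorm A a"
      using banach_algebra_norm_mult[OF A ab(1) x] by (simp add: mult.commute)
    show "vnorm B (amult B b y) \<le> vnorm B y * vnorm B b"
      using banach_algebra_norm_mult[OF B ab(2) y] by (simp add: mult.commute)
  qed (simp_all add: cl eqs)
qed

text \<open>\<open>bilform\<close> looks at the carriers only, whereas functions that agree there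
  may differ elsewhere; this transfers the test that \<open>tens_of\<close> and \<open>etens\<close>
  perform on their argument.\<close>

lemma bilform_cong:
  assumes "\<And>x y. x \<in> vcarrier A \<Longrightarrow> y \<in> vcarrier B \<Longrightarrow> \<phi> x y = \<psi> x y" and \<psi>: "bilform A B \<psi>"
  shows "bilform A B \<phi>"
proof -
  obtain K where K: "\<And>a b. a \<in> vcarrier A \<Longrightarrow> b \<in> vcarrier B \<Longrightarrow>
      cmod (\<psi> a b) \<le> K * (vnorm A a * vnorm B b)"
    using bilform_bound[OF \<psi>] by metis
  show ?thesis
    by (rule bilformI[where K = K])
      (simp_all add: assms(1) cbanach_plus[OF cA] cbanach_plus[OF cB] cbanach_smul[OF cA]
        cbanach_smul[OF cB] bilform_left[OF \<psi>] bilform_right[OF \<psi>] bilform_smul_left[OF \<psi>]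
        bilform_smul_right[OF \<psi>] K)
qed

lemma etens_mult_tens_of:
  assumes v: "v \<in> vcarrier A" and u: "u \<in> vcarrier B" and ab: "tensor_rep A B a b"
  shows "amult T (etens v u) (tens_of A B a b) =
    tens_of A B (\<lambda>n. amult A v (a n)) (\<lambda>n. amult B u (b n))"
proof
  fix \<phi>
  show "amult T (etens v u) (tens_of A B a b) \<phi> =
      tens_of A B (\<lambda>n. amult A v (a n)) (\<lambda>n. amult B u (b n)) \<phi>"
  proof (cases "bilform A B \<phi>")
    case \<phi>: True
    let ?G = "\<lambda>x y. tens_of A B a b (\<lambda>x' y'. \<phi> (amult A x x') (amult B y y'))"
    let ?f = "\<lambda>x y n. \<phi> (amult A x (a n)) (amult B y (b n))"
    have G: "?G x y = (\<Sum>n. ?f x y n)" if "x \<in> vcarrier A" "y \<in> vcarrier B" for x y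
      using bilform_mult(1)[OF \<phi> that] by (simp add: tens_of_def)
    have summ: "summable (?f x y)" if "x \<in> vcarrier A" "y \<in> vcarrier B" for x y
      using bilform_summable[OF ab bilform_mult(1)[OF \<phi> that]] .
    note cl = tensor_rep_carrier[OF ab] banach_algebra_mult[OF A] banach_algebra_mult[OF B]
      cbanach_plus[OF cA] cbanach_plus[OF cB] cbanach_smul[OF cA] cbanach_smul[OF cB]
    note eqs = bilform_left[OF \<phi>] bilform_right[OF \<phi>] bilform_smul_left[OF \<phi>] bilform_smul_right[OF \<phi>]
      banach_algebra_distrib_right[OF A] banach_algebra_distrib_right[OF B]
      banach_algebra_smul_left[OF A] banach_algebra_smul_left[OF B]
    obtain K where K: "K \<ge> 0" "\<And>a b. a \<in> vcarrier A \<Longrightarrow> b \<in> vcarrier B \<Longrightarrow>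
        cmod (\<phi> a b) \<le> K * (vnorm A a * vnorm B b)"
      using bilform_bound[OF \<phi>] by metis
    let ?S = "\<Sum>n. vnorm A (a n) * vnorm B (b n)"
    \<comment> \<open>The product feeds \<open>?G\<close> to \<open>etens v u\<close>, which returns
      its default 0 on anything but a bounded bilinear form. So this is the substance of the lemma;
      the bound comes from that of \<open>\<phi>\<close> and the norm sum of the
      representation.\<close>
    have "bilform A B ?G"
    proof (rule bilformI)
      fix x y assume xy: "x \<in> vcarrier A" "y \<in> vcarrier B"
      show "cmod (?G x y) \<le> (K * ?S) * (vnorm A x * vnorm B y)"
      proof -
        have le: "norm (?f x y n) \<le> K * (vnorm A x * vnorm B y) * (vnorm A (a n) * vnorm B (b n))" for n
          using K(2)[of "amult A x (a n)" "amult B y (b n)"] xy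
            mult_left_mono[OF tensor_norm_mult_le[OF ab xy, of n] K(1)]
          by (simp add: cl mult.assoc)
        have "norm (\<Sum>n. ?f x y n) \<le> (\<Sum>n. K * (vnorm A x * vnorm B y) * (vnorm A (a n) * vnorm B (b n)))"
          by (rule norm_suminf_le[OF le summable_mult[OF tensor_rep_summable[OF ab]]])
        also have "\<dots> = K * (vnorm A x * vnorm B y) * ?S"
          by (rule suminf_mult[OF tensor_rep_summable[OF ab]])
        finally show ?thesis
          by (simp add: G[OF xy] mult_ac)
      qed
    qed (simp_all add: G cl eqs suminf_add[OF summ summ] suminf_mult[OF summ])
    then show ?thesis
      using \<phi> G[OF v u] by (simp add: ptensor_simps etens_def) (simp add: tens_of_def)
  qed (simp add: ptensor_simps tens_of_def)
qed

text \<open>Here the inner functional is an evaluation, so the function seen by the outer one is, on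
  the carriers, the form \<open>\<phi>\<close> translated on the right.\<close>

lemma tens_of_mult_etens:
  assumes v: "v \<in> vcarrier A" and u: "u \<in> vcarrier B" and ab: "tensor_rep A B a b"
  shows "amult T (tens_of A B a b) (etens v u) =
    tens_of A B (\<lambda>n. amult A (a n) v) (\<lambda>n. amult B (b n) u)"
proof
  fix \<phi>
  show "amult T (tens_of A B a b) (etens v u) \<phi> =
      tens_of A B (\<lambda>n. amult A (a n) v) (\<lambda>n. amult B (b n) u) \<phi>"
  proof (cases "bilform A B \<phi>")
    case \<phi>: True
    let ?G = "\<lambda>x y. etens v u (\<lambda>x' y'. \<phi> (amult A x x') (amult B y y'))"
    have G: "?G x y = \<phi> (amult A x v) (amult B y u)" if "x \<in> vcarrier A" "y \<in> vcarrier B" for x y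
      using bilform_mult(1)[OF \<phi> that] by (simp add: etens_def)
    have "bilform A B ?G"
      using G by (rule bilform_cong[OF _ bilform_mult(2)[OF \<phi> v u]])
    then show ?thesis
      using \<phi> G tensor_rep_carrier[OF ab] by (simp add: ptensor_simps tens_of_def)
  qed (simp add: ptensor_simps tens_of_def)
qed

lemma etens_mult:
  assumes "a \<in> vcarrier A" "b \<in> vcarrier B" "a' \<in> vcarrier A" "b' \<in> vcarrier B"
  shows "amult T (etens a b) (etens a' b') = etens (amult A a a') (amult B b b')"
proof -
  have "(\<lambda>n. amult A a (single (vzero A) a' n)) = single (vzero A) (amult A a a')"
    and "(\<lambda>n. amult B b (single (vzero B) b' n)) = single (vzero B) (amult B b b')"
    using assms by (auto simp: single_def amult_zero_right[OF A] amult_zero_right[OF B])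
  then show ?thesis
    using assms etens_mult_tens_of[OF assms(1,2) tensor_rep_single[OF assms(3,4)]]
    by (simp add: etens_eq_tens_of banach_algebra_mult[OF A] banach_algebra_mult[OF B])
qed

text \<open>Absolute convergence makes the interleaved series sum to the total of the two. The norm
  sum is left as one series of pairwise sums, the shape needed for a termwise limit.\<close>

lemma
  assumes ab: "tensor_rep A B a b" and ab': "tensor_rep A B a' b'"
  shows tensor_rep_interleave: "tensor_rep A B (interleave a a') (interleave b b')"
    and sum_norm_interleave: "(\<Sum>n. vnorm A (interleave a a' n) * vnorm B (interleave b b' n)) =
      (\<Sum>n. vnorm A (a n) * vnorm B (b n) + vnorm A (a' n) * vnorm B (b' n))"
    and tens_of_interleave: "tens_of A B (interleave a a') (interleave b b') =
      vplus T (tens_of A B a b) (tens_of A B a' b')"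
proof -
  have s: "(\<lambda>n. vnorm A (interleave a a' n) * vnorm B (interleave b b' n)) sums
      ((\<Sum>n. vnorm A (a n) * vnorm B (b n)) + (\<Sum>n. vnorm A (a' n) * vnorm B (b' n)))"
    using sums_interleave_real[OF summable_sums[OF tensor_rep_summable[OF ab]]
        summable_sums[OF tensor_rep_summable[OF ab']]]
    by (simp add: interleave_def[abs_def] if_distrib cong: if_cong)
  then show "(\<Sum>n. vnorm A (interleave a a' n) * vnorm B (interleave b b' n)) =
      (\<Sum>n. vnorm A (a n) * vnorm B (b n) + vnorm A (a' n) * vnorm B (b' n))"
    by (simp add: sums_iff suminf_add tensor_rep_summable[OF ab] tensor_rep_summable[OF ab'])
  show "tensor_rep A B (interleave a a') (interleave b b')"
    unfolding tensor_rep_def using s tensor_rep_carrier[OF ab] tensor_rep_carrier[OF ab']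
    by (auto simp: sums_iff interleave_def)
  show "tens_of A B (interleave a a') (interleave b b') =
      vplus T (tens_of A B a b) (tens_of A B a' b')"
  proof
    fix \<phi>
    have "(\<Sum>n. \<phi> (interleave a a' n) (interleave b b' n)) =
        (\<Sum>n. \<phi> (a n) (b n)) + (\<Sum>n. \<phi> (a' n) (b' n))" if "bilform A B \<phi>"
      using sums_interleave_complex[OF summable_sums[OF bilform_summable[OF ab that]]
          summable_sums[OF bilform_summable[OF ab' that]]]
      by (simp add: interleave_def[abs_def] if_distrib sums_iff cong: if_cong)
    then show "tens_of A B (interleave a a') (interleave b b') \<phi> =
        vplus T (tens_of A B a b) (tens_of A B a' b') \<phi>"
      by (simp add: tens_of_def ptensor_simps)
  qed
qed

section \<open>Closure of the carrier and the action of \<open>v \<otimes> u\<close> on it\<close>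

lemma ptensor_plus_closed:
  assumes "\<Phi> \<in> vcarrier T" "\<Psi> \<in> vcarrier T"
  shows "vplus T \<Phi> \<Psi> \<in> vcarrier T"
proof -
  obtain a b a' b' where "tensor_rep A B a b" "\<Phi> = tens_of A B a b"
    "tensor_rep A B a' b'" "\<Psi> = tens_of A B a' b'"
    using assms unfolding ptensor_simps by blast
  then show ?thesis
    using tens_of_in_carrier[OF tensor_rep_interleave] tens_of_interleave by metis
qed

lemma ptensor_smul_closed:
  assumes "\<Phi> \<in> vcarrier T"
  shows "vsmul T z \<Phi> \<in> vcarrier T"
proof -
  obtain a b where ab: "tensor_rep A B a b" and \<Phi>: "\<Phi> = tens_of A B a b"
    using assms unfolding ptensor_simps by blast
  have "tensor_rep A B (\<lambda>n. vsmul A z (a n)) b"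
    using tensor_rep_carrier[OF ab]
    by (intro tensor_rep_dominated[OF ab, where L = "cmod z"])
      (simp_all add: cbanach_smul[OF cA] cbanach_norm_smul[OF cA])
  moreover have "vsmul T z \<Phi> = tens_of A B (\<lambda>n. vsmul A z (a n)) b"
    unfolding \<Phi> using tensor_rep_carrier[OF ab]
    by (auto simp: ptensor_simps tens_of_def bilform_smul_left suminf_mult bilform_summable[OF ab])
  ultimately show ?thesis using tens_of_in_carrier by simp
qed

lemma etens_mult_closed:
  assumes "v \<in> vcarrier A" "u \<in> vcarrier B" "c \<in> vcarrier T"
  shows "amult T (etens v u) c \<in> vcarrier T"
proof -
  obtain a b where "tensor_rep A B a b" "c = tens_of A B a b"
    using assms(3) unfolding ptensor_simps by blast
  then show ?thesis
    using etens_mult_tens_of[OF assms(1,2)] tens_of_in_carrier tensor_rep_mult assms(1,2) by metis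
qed

lemma etens_central:
  assumes v: "v \<in> vcarrier A" "central A v" and u: "u \<in> vcarrier B" "central B u" and c: "c \<in> vcarrier T"
  shows "amult T (etens v u) c = amult T c (etens v u)"
proof -
  obtain a b where ab: "tensor_rep A B a b" and c: "c = tens_of A B a b"
    using c unfolding ptensor_simps by blast
  have "amult A v (a n) = amult A (a n) v" "amult B u (b n) = amult B (b n) u" for n
    using v(2) u(2) tensor_rep_carrier[OF ab] unfolding central_def by blast+
  then show ?thesis
    unfolding c etens_mult_tens_of[OF v(1) u(1) ab] tens_of_mult_etens[OF v(1) u(1) ab] by simp
qed

text \<open>The zero product is written as a zero multiple of \<open>c\<close>, so that homogeneity
  of a derivation immediately sends it to 0.\<close>

lemma etens_mult_zero:
  assumes v: "v \<in> vcarrier A"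
  shows "amult T (etens v (vzero B)) c = vsmul T 0 c"
proof -
  have "\<phi> v (vzero B) = 0" if \<phi>: "bilform A B \<phi>" for \<phi>
  proof -
    obtain K where "cmod (\<phi> v (vzero B)) \<le> K * (vnorm A v * vnorm B (vzero B))"
      using bilform_bound[OF \<phi>] v cbanach_zero[OF cB] by metis
    then show ?thesis by (simp add: cbanach_norm_zero[OF cB])
  qed
  then have "etens v (vzero B) = (\<lambda>\<phi>. 0)" by (auto simp: etens_def)
  then show ?thesis by (simp add: ptensor_simps)
qed

lemma etens_mult_add:
  assumes v: "v \<in> vcarrier A" and u: "u \<in> vcarrier B" and e: "e \<in> vcarrier B"
  shows "amult T (etens v (vplus B u (vsmul B z e))) c =
    vplus T (amult T (etens v u) c) (vsmul T z (amult T (etens v e) c))"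
proof -
  have "etens v (vplus B u (vsmul B z e)) \<phi> = etens v u \<phi> + z * etens v e \<phi>" for \<phi>
    using assms by (simp add: etens_def bilform_right bilform_smul_right cbanach_smul[OF cB])
  then show ?thesis by (auto simp: ptensor_simps)
qed

text \<open>Multiplying a series termwise gives
  \<open>v a\<^sub>n \<otimes> \<kappa>(b\<^sub>n) e\<close>; moving the scalars to the left factor
  collapses it to \<open>v a \<otimes> e\<close>, where \<open>a\<close> is the sum of the
  \<open>\<kappa>(b\<^sub>n) a\<^sub>n\<close>.\<close>

lemma etens_mult_atom:
  assumes v: "v \<in> vcarrier A" and e: "e \<in> vcarrier B" "e \<noteq> vzero B"
    and \<kappa>: "\<And>b. b \<in> vcarrier B \<Longrightarrow> amult B e b = vsmul B (\<kappa> b) e" and c: "c \<in> vcarrier T"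
  obtains a where "a \<in> vcarrier A" "amult T (etens v e) c = etens (amult A v a) e"
proof -
  obtain a b where ab: "tensor_rep A B a b" and c: "c = tens_of A B a b"
    using c unfolding ptensor_simps by blast
  note an = tensor_rep_carrier(1)[OF ab] and bn = tensor_rep_carrier(2)[OF ab]
  have epos: "vnorm B e > 0"
    using norm_B[OF e(1)] e(2) cbanach_norm_eq_0[OF cB e(1)] by (auto simp: less_le)
  \<comment> \<open>The norm of \<open>e b\<close> is \<open>cmod (\<kappa> b)\<close> times that of
    \<open>e\<close>, and at most the product of the norms of \<open>e\<close> and \<open>b\<close>;
    cancelling the norm of \<open>e\<close> leaves a contractive \<open>\<kappa>\<close>, hence
    absolute convergence.\<close>
  have chi: "cmod (\<kappa> b) \<le> vnorm B b" if "b \<in> vcarrier B" for b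
    using banach_algebra_norm_mult[OF B e(1) that] epos
    by (simp add: \<kappa>[OF that] cbanach_norm_smul[OF cB e(1)] mult.commute)
  have "summable (\<lambda>n. vnorm A (vsmul A (\<kappa> (b n)) (a n)))"
  proof (rule summable_comparison_test'[OF tensor_rep_summable[OF ab], of 0])
    show "norm (vnorm A (vsmul A (\<kappa> (b n)) (a n))) \<le> vnorm A (a n) * vnorm B (b n)" for n
      using mult_right_mono[OF chi[OF bn] norm_A[OF an]] norm_A[OF an[of n]]
      by (simp add: cbanach_norm_smul[OF cA an] mult.commute abs_mult)
  qed
  from absolutely_convergent_sum[OF cA cbanach_smul[OF cA an] this] obtain s
    where s: "s \<in> vcarrier A"
      "\<And>f. f \<in> dual A \<Longrightarrow> (\<lambda>n. f (vsmul A (\<kappa> (b n)) (a n))) sums f s" by metis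
  have "tens_of A B (\<lambda>n. amult A v (a n)) (\<lambda>n. amult B e (b n)) \<phi> = etens (amult A v s) e \<phi>" for \<phi>
  proof (cases "bilform A B \<phi>")
    case \<phi>: True
    obtain K where K: "K \<ge> 0" "\<And>a b. a \<in> vcarrier A \<Longrightarrow> b \<in> vcarrier B \<Longrightarrow>
        cmod (\<phi> a b) \<le> K * (vnorm A a * vnorm B b)"
      using bilform_bound[OF \<phi>] by metis
    \<comment> \<open>Testing the sum against this functional pulls it out of \<open>\<phi>\<close>;
      the value 0 off the carrier is part of the convention for \<open>dual\<close>.\<close>
    let ?f = "\<lambda>x. if x \<in> vcarrier A then \<phi> (amult A v x) e else 0"
    have "?f \<in> dual A"
    proof (rule dualI)
      fix x assume x: "x \<in> vcarrier A"
      have "K * (vnorm A (amult A v x) * vnorm B e) \<le> K * ((vnorm A v * vnorm A x) * vnorm B e)"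
        using K(1) banach_algebra_norm_mult[OF A v x] norm_B[OF e(1)]
        by (intro mult_left_mono mult_right_mono)
      then show "cmod (?f x) \<le> (K * vnorm A v * vnorm B e) * vnorm A x"
        using K(2)[OF banach_algebra_mult[OF A v x] e(1)] x by (simp add: mult_ac)
    qed (simp_all add: v e(1) cbanach_plus[OF cA] cbanach_smul[OF cA] banach_algebra_mult[OF A]
        banach_algebra_distrib_left[OF A] banach_algebra_smul_right[OF A]
        bilform_left[OF \<phi>] bilform_smul_left[OF \<phi>])
    from s(2)[OF this] have "(\<lambda>n. \<kappa> (b n) * \<phi> (amult A v (a n)) e) sums \<phi> (amult A v s) e"
      by (simp add: s(1) v e(1) an cbanach_smul[OF cA] banach_algebra_mult[OF A]
          banach_algebra_smul_right[OF A] bilform_smul_left[OF \<phi>])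
    moreover have "\<phi> (amult A v (a n)) (amult B e (b n)) = \<kappa> (b n) * \<phi> (amult A v (a n)) e" for n
      by (simp add: \<kappa>[OF bn] bilform_smul_right[OF \<phi> banach_algebra_mult[OF A v an] e(1)])
    ultimately show ?thesis
      using \<phi> by (simp add: tens_of_def etens_def sums_iff)
  qed (simp add: tens_of_def etens_def)
  then have "amult T (etens v e) c = etens (amult A v s) e"
    unfolding c etens_mult_tens_of[OF v e(1) ab] by blast
  then show ?thesis using that s(1) by blast
qed

section \<open>The approximate identity of the tensor product\<close>

lemma ptensor_defect_norm_le:
  assumes v: "v \<in> vcarrier A" and u: "u \<in> vcarrier B" and ab: "tensor_rep A B a b"
  shows "vnorm T (vminus T (amult T (etens v u) (tens_of A B a b)) (tens_of A B a b)) \<le>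
    (\<Sum>n. vnorm A (vminus A (amult A v (a n)) (a n)) * vnorm B (amult B u (b n)) +
         vnorm A (a n) * vnorm B (vminus B (amult B u (b n)) (b n)))"
proof -
  note an = tensor_rep_carrier(1)[OF ab] and bn = tensor_rep_carrier(2)[OF ab]
  note van = banach_algebra_mult[OF A v an] and ubn = banach_algebra_mult[OF B u bn]
  let ?va = "\<lambda>n. vminus A (amult A v (a n)) (a n)" and ?ub = "\<lambda>n. vminus B (amult B u (b n)) (b n)"
  \<comment> \<open>These bounds involve the norms of \<open>v\<close> and \<open>u\<close> and are
    not uniform along the nets; they serve only to make the two new series representations.\<close>
  have minus_le: "vnorm C (vminus C (amult C w x) x) \<le> (vnorm C w + 1) * vnorm C x"
    if C: "banach_algebra C" and w: "w \<in> vcarrier C" and x: "x \<in> vcarrier C" for C :: "'z calg" and w x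
  proof -
    note cC = banach_algebra_cbanach[OF C]
    have "vnorm C (vminus C (amult C w x) x) \<le> vnorm C (amult C w x) + vnorm C x"
      using cbanach_norm_triangle[OF cC banach_algebra_mult[OF C w x] cbanach_smul[OF cC x, of "-1"]]
      by (simp add: vminus_def cbanach_norm_smul[OF cC x])
    then show ?thesis using banach_algebra_norm_mult[OF C w x] by (simp add: algebra_simps)
  qed
  have r1: "tensor_rep A B ?va (\<lambda>n. amult B u (b n))"
  proof (rule tensor_rep_dominated[OF ab])
    show "vnorm A (?va n) * vnorm B (amult B u (b n))
        \<le> ((vnorm A v + 1) * vnorm B u) * (vnorm A (a n) * vnorm B (b n))" for n
      using mult_mono[OF minus_le[OF A v an] banach_algebra_norm_mult[OF B u bn]]
        norm_A[OF v] norm_A[OF an[of n]] norm_B[OF ubn[of n]] by (simp add: mult_ac)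
  qed (simp_all add: ubn cbanach_minus[OF cA van an])
  have r2: "tensor_rep A B a ?ub"
  proof (rule tensor_rep_dominated[OF ab])
    show "vnorm A (a n) * vnorm B (?ub n) \<le> (vnorm B u + 1) * (vnorm A (a n) * vnorm B (b n))" for n
      using mult_left_mono[OF minus_le[OF B u bn] norm_A[OF an]] by (simp add: mult_ac)
  qed (simp_all add: an cbanach_minus[OF cB ubn bn])
  \<comment> \<open>Termwise this is the splitting \<open>v a \<otimes> u b - a \<otimes> b = (v a -
    a) \<otimes> u b + a \<otimes> (u b - b)\<close>.\<close>
  have "vminus T (amult T (etens v u) (tens_of A B a b)) (tens_of A B a b) \<phi> =
      tens_of A B (interleave ?va a) (interleave (\<lambda>n. amult B u (b n)) ?ub) \<phi>" for \<phi>
  proof (cases "bilform A B \<phi>")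
    case \<phi>: True
    have t: "\<phi> (?va n) (amult B u (b n)) + \<phi> (a n) (?ub n) =
        \<phi> (amult A v (a n)) (amult B u (b n)) - \<phi> (a n) (b n)" for n
      by (simp add: vminus_def van an ubn bn cbanach_smul[OF cA] cbanach_smul[OF cB]
          bilform_left[OF \<phi>] bilform_right[OF \<phi>] bilform_smul_left[OF \<phi>] bilform_smul_right[OF \<phi>])
    have "(\<Sum>n. \<phi> (?va n) (amult B u (b n))) + (\<Sum>n. \<phi> (a n) (?ub n)) =
        (\<Sum>n. \<phi> (amult A v (a n)) (amult B u (b n))) - (\<Sum>n. \<phi> (a n) (b n))"
      unfolding suminf_add[OF bilform_summable[OF r1 \<phi>] bilform_summable[OF r2 \<phi>]] t
      by (rule suminf_diff[OF bilform_summable[OF tensor_rep_mult[OF ab v u] \<phi>]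
            bilform_summable[OF ab \<phi>], symmetric])
    then show ?thesis
      unfolding tens_of_interleave[OF r1 r2] etens_mult_tens_of[OF v u ab] vminus_def[of T]
      using \<phi> by (simp add: ptensor_simps tens_of_def)
  next
    case False
    then show ?thesis
      unfolding tens_of_interleave[OF r1 r2] etens_mult_tens_of[OF v u ab] vminus_def[of T]
      by (simp add: ptensor_simps tens_of_def)
  qed
  then have eq: "vminus T (amult T (etens v u) (tens_of A B a b)) (tens_of A B a b) =
      tens_of A B (interleave ?va a) (interleave (\<lambda>n. amult B u (b n)) ?ub)"
    by blast
  show ?thesis
    unfolding eq using ptensor_norm_le[OF tensor_rep_interleave[OF r1 r2]]
    by (simp only: sum_norm_interleave[OF r1 r2])
qed

text \<open>Dominated convergence for series: each term of the defect bound tends to 0, and the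
  multiplier bounds dominate all terms by a fixed multiple of the summable representation.\<close>

lemma ptensor_approximate_identity:
  assumes F: "mbai_with P A F" and G: "mbai_with Q B G" and c: "c \<in> vcarrier T"
  shows "((\<lambda>(v, u). vnorm T (vminus T (amult T (etens v u) c) c)) \<longlongrightarrow> 0) (F \<times>\<^sub>F G)"
proof -
  obtain a b where ab: "tensor_rep A B a b" and c: "c = tens_of A B a b"
    using c unfolding ptensor_simps by blast
  note an = tensor_rep_carrier(1)[OF ab] and bn = tensor_rep_carrier(2)[OF ab]
  obtain M where M: "F \<noteq> bot" "M \<ge> 0"
    "\<forall>c\<in>vcarrier A. ((\<lambda>u. vnorm A (vminus A (amult A u c) c)) \<longlongrightarrow> 0) F"
    "\<forall>\<^sub>F u in F. u \<in> vcarrier A \<and> P u \<and> (\<forall>c\<in>vcarrier A. vnorm A (amult A u c) \<le> M * vnorm A c)"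
    using mbaiD[OF A F] .
  obtain N where N: "G \<noteq> bot" "N \<ge> 0"
    "\<forall>c\<in>vcarrier B. ((\<lambda>u. vnorm B (vminus B (amult B u c) c)) \<longlongrightarrow> 0) G"
    "\<forall>\<^sub>F u in G. u \<in> vcarrier B \<and> Q u \<and> (\<forall>c\<in>vcarrier B. vnorm B (amult B u c) \<le> N * vnorm B c)"
    using mbaiD[OF B G] .
  let ?good = "\<lambda>v u. (v \<in> vcarrier A \<and> (\<forall>c\<in>vcarrier A. vnorm A (amult A v c) \<le> M * vnorm A c)) \<and>
      (u \<in> vcarrier B \<and> (\<forall>c\<in>vcarrier B. vnorm B (amult B u c) \<le> N * vnorm B c))"
  have good: "\<forall>\<^sub>F (v, u) in F \<times>\<^sub>F G. ?good v u"
    using eventually_prodI[OF M(4) N(4)] by (rule eventually_mono) auto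
  define W where "W n p = vnorm A (vminus A (amult A (fst p) (a n)) (a n)) * vnorm B (amult B (snd p) (b n)) +
         vnorm A (a n) * vnorm B (vminus B (amult B (snd p) (b n)) (b n))" for n p
  \<comment> \<open>Replacing the norm of \<open>u b\<^sub>n\<close> by its multiplier bound leaves
    a null factor times a constant in each summand, so the limit can be read off.\<close>
  define R where "R n p = vnorm A (vminus A (amult A (fst p) (a n)) (a n)) * (N * vnorm B (b n)) +
         vnorm A (a n) * vnorm B (vminus B (amult B (snd p) (b n)) (b n))" for n p
  have nonneg: "0 \<le> W n (v, u)" if "v \<in> vcarrier A" "u \<in> vcarrier B" for n v u
    unfolding W_def using that an bn
    by (auto intro!: add_nonneg_nonneg mult_nonneg_nonneg norm_A norm_B cbanach_minus[OF cA]
        cbanach_minus[OF cB] banach_algebra_mult[OF A] banach_algebra_mult[OF B])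
  have WR: "W n (v, u) \<le> R n (v, u)" if "?good v u" for n v u
    unfolding W_def R_def using that an bn
    by (auto intro!: mult_left_mono norm_A cbanach_minus[OF cA] banach_algebra_mult[OF A])
  have lim: "(W n \<longlongrightarrow> 0) (F \<times>\<^sub>F G)" for n
  proof (rule Lim_null_comparison)
    show "\<forall>\<^sub>F p in F \<times>\<^sub>F G. norm (W n p) \<le> R n p"
      using good by (rule eventually_mono) (use nonneg WR in auto)
    have "(R n \<longlongrightarrow> 0 * (N * vnorm B (b n)) + vnorm A (a n) * 0) (F \<times>\<^sub>F G)"
      unfolding R_def
      by (intro tendsto_intros filterlim_compose[OF M(3)[rule_format, OF an] filterlim_fst]
          filterlim_compose[OF N(3)[rule_format, OF bn] filterlim_snd])
    then show "(R n \<longlongrightarrow> 0) (F \<times>\<^sub>F G)" by simp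
  qed
  \<comment> \<open>\<open>M + 1\<close> bounds the effect of \<open>v a - a\<close>,
    \<open>N\<close> that of \<open>u b\<close>, and \<open>N + 1\<close> that of
    \<open>u b - b\<close>.\<close>
  let ?L = "(M + 1) * N + (N + 1)"
  have Rb: "R n (v, u) \<le> ?L * (vnorm A (a n) * vnorm B (b n))" if g: "?good v u" for n v u
  proof -
    have "vnorm A (vminus A (amult A v (a n)) (a n)) \<le> vnorm A (amult A v (a n)) + vnorm A (a n)"
      using cbanach_norm_triangle[OF cA banach_algebra_mult[OF A _ an] cbanach_smul[OF cA an], of v n "-1" n] g
      by (simp add: vminus_def cbanach_norm_smul[OF cA an])
    then have 1: "vnorm A (vminus A (amult A v (a n)) (a n)) \<le> (M + 1) * vnorm A (a n)"
      using g an[of n] by (auto simp: distrib_right dest: bspec)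
    have "vnorm B (vminus B (amult B u (b n)) (b n)) \<le> vnorm B (amult B u (b n)) + vnorm B (b n)"
      using cbanach_norm_triangle[OF cB banach_algebra_mult[OF B _ bn] cbanach_smul[OF cB bn], of u n "-1" n] g
      by (simp add: vminus_def cbanach_norm_smul[OF cB bn])
    then have 2: "vnorm B (vminus B (amult B u (b n)) (b n)) \<le> (N + 1) * vnorm B (b n)"
      using g bn[of n] by (auto simp: distrib_right dest: bspec)
    have "R n (v, u) \<le> ((M + 1) * vnorm A (a n)) * (N * vnorm B (b n)) +
        vnorm A (a n) * ((N + 1) * vnorm B (b n))"
      unfolding R_def fst_conv snd_conv
      using mult_right_mono[OF 1, of "N * vnorm B (b n)"] mult_left_mono[OF 2 norm_A[OF an[of n]]]
        N(2) norm_B[OF bn[of n]] by simp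
    then show ?thesis by (simp add: algebra_simps)
  qed
  \<comment> \<open>Tannery's theorem asks for domination eventually in the index and the pair
    jointly; here it holds at every index as soon as the pair is good.\<close>
  have dom: "\<forall>\<^sub>F (n, p) in sequentially \<times>\<^sub>F (F \<times>\<^sub>F G). norm (W n p) \<le> ?L * (vnorm A (a n) * vnorm B (b n))"
  proof -
    have "\<forall>\<^sub>F p in F \<times>\<^sub>F G. \<forall>n. norm (W n p) \<le> ?L * (vnorm A (a n) * vnorm B (b n))"
      using good
    proof (rule eventually_mono)
      fix p assume "case p of (v, u) \<Rightarrow> ?good v u"
      then obtain v u where p: "p = (v, u)" and g: "?good v u" by (cases p) simp
      have "norm (W n (v, u)) \<le> ?L * (vnorm A (a n) * vnorm B (b n))" for n
        using nonneg[of v u n] WR[OF g, of n] Rb[OF g, of n] g by auto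
      then show "\<forall>n. norm (W n p) \<le> ?L * (vnorm A (a n) * vnorm B (b n))" unfolding p by blast
    qed
    then show ?thesis
      unfolding eventually_prod_filter
      by (intro exI[of _ "\<lambda>_. True"] exI[of _ "\<lambda>p. \<forall>n. norm (W n p) \<le> ?L * (vnorm A (a n) * vnorm B (b n))"]) auto
  qed
  have "((\<lambda>p. \<Sum>n. W n p) \<longlongrightarrow> (\<Sum>n. 0)) (F \<times>\<^sub>F G)"
    using tannerys_theorem[OF lim dom summable_mult[OF tensor_rep_summable[OF ab]]] M(1) N(1)
    by (simp add: prod_filter_eq_bot)
  then have sum0: "((\<lambda>p. \<Sum>n. W n p) \<longlongrightarrow> 0) (F \<times>\<^sub>F G)" by simp
  show ?thesis
  proof (rule Lim_null_comparison[OF _ sum0])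
    show "\<forall>\<^sub>F p in F \<times>\<^sub>F G. norm (case p of (v, u) \<Rightarrow> vnorm T (vminus T (amult T (etens v u) c) c))
        \<le> (\<Sum>n. W n p)"
      using good
    proof (rule eventually_mono)
      fix p assume "case p of (v, u) \<Rightarrow> ?good v u"
      then obtain v u where p: "p = (v, u)" and v: "v \<in> vcarrier A" and u: "u \<in> vcarrier B"
        by (cases p) simp
      have cT: "c \<in> vcarrier T" unfolding c by (rule tens_of_in_carrier[OF ab])
      have "vminus T (amult T (etens v u) c) c \<in> vcarrier T"
        unfolding vminus_def
        by (intro ptensor_plus_closed etens_mult_closed ptensor_smul_closed v u cT)
      from ptensor_norm_nonneg[OF this] ptensor_defect_norm_le[OF v u ab]
      show "norm (case p of (v, u) \<Rightarrow> vnorm T (vminus T (amult T (etens v u) c) c)) \<le> (\<Sum>n. W n p)"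
        by (simp add: W_def c p)
    qed
  qed
qed

end

section \<open>Approximating the derivation on multiples of \<open>v \<otimes> u\<close>\<close>

lemma atom_derivation_approx:
  fixes A :: "'a calg" and B :: "('s \<Rightarrow> complex) calg" and X :: "('x, ('a \<Rightarrow> ('s \<Rightarrow> complex) \<Rightarrow> complex) \<Rightarrow> complex) bimod"
  assumes A: "banach_algebra A" and B: "banach_algebra B"
    and amen: "approx_semi_amenable TYPE('x) A"
    and M: "banach_bimodule (ptensor A B) X" and D: "cont_derivation (ptensor A B) X D"
    and v: "v \<in> vcarrier A" "central A v" and e: "atom B e" "central B e"
    and Phi: "finite \<Phi>" "\<Phi> \<subseteq> vcarrier (ptensor A B)" and r: "r > 0"
  obtains \<xi> \<eta> where "\<xi> \<in> dual X" "\<eta> \<in> dual X"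
    "\<And>c x. c \<in> \<Phi> \<Longrightarrow> x \<in> vcarrier X \<Longrightarrow>
      cmod (D (amult (ptensor A B) (algebra_pair.etens A B v e) c) x -
        (\<xi> (ract X x c) - \<eta> (lact X c x))) \<le> r * vnorm X x"
proof -
  interpret algebra_pair A B by unfold_locales (rule A B)+
  obtain s where eB: "e \<in> vcarrier B" "e \<noteq> vzero B" and idem: "amult B e e = e"
    and es: "\<And>b. b \<in> vcarrier B \<Longrightarrow> amult B e b = vsmul B (b s) e"
    using e(1) unfolding atom_def by blast
  \<comment> \<open>Idempotence of \<open>e\<close> makes \<open>a \<mapsto> a \<otimes> e\<close>
    multiplicative. Its bound is the norm of \<open>e\<close>, raised to 1 if necessary to meet the
    requirement of the locale.\<close>
  interpret hom: algebra_hom_bimodule A T "\<lambda>a. etens a e" X "max 1 (vnorm B e)"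
  proof
    fix a assume a: "a \<in> vcarrier A"
    show "vnorm T (etens a e) \<le> max 1 (vnorm B e) * vnorm A a"
      using etens_norm_le[OF a eB(1)] mult_right_mono[OF max.cobounded2[of "vnorm B e" 1] norm_A[OF a]]
      by (simp add: mult.commute)
    show "etens a e \<in> vcarrier T" by (rule etens_in_carrier[OF a eB(1)])
    then show "0 \<le> vnorm T (etens a e)" by (rule ptensor_norm_nonneg)
    show "etens (vsmul A z a) e = vsmul T z (etens a e)" for z
      by (rule etens_smul_left[OF a eB(1)])
    fix b assume b: "b \<in> vcarrier A"
    show "etens (vplus A a b) e = vplus T (etens a e) (etens b e)"
      by (rule etens_plus_left[OF a b eB(1)])
    show "etens (amult A a b) e = amult T (etens a e) (etens b e)"
      unfolding etens_mult[OF a eB(1) b eB(1)] idem ..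
  qed (use A M in auto)
  have "\<exists>a. a \<in> vcarrier A \<and> amult T (etens v e) c = etens (amult A v a) e" if "c \<in> \<Phi>" for c
  proof -
    have "c \<in> vcarrier T" using that Phi(2) by blast
    from etens_mult_atom[OF v(1) eB es this] show ?thesis by blast
  qed
  then obtain \<alpha> where \<alpha>: "\<And>c. c \<in> \<Phi> \<Longrightarrow> \<alpha> c \<in> vcarrier A"
    "\<And>c. c \<in> \<Phi> \<Longrightarrow> amult T (etens v e) c = etens (amult A v (\<alpha> c)) e"
    by metis
  have fin: "finite ((\<lambda>c. amult A v (\<alpha> c)) ` \<Phi>)" "(\<lambda>c. amult A v (\<alpha> c)) ` \<Phi> \<subseteq> vcarrier A"
    using Phi(1) \<alpha>(1) banach_algebra_mult[OF A v(1)] by auto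
  obtain \<xi> \<eta> where p: "\<xi> \<in> dual X" "\<eta> \<in> dual X"
    "\<And>a x. a \<in> (\<lambda>c. amult A v (\<alpha> c)) ` \<Phi> \<Longrightarrow> x \<in> vcarrier X \<Longrightarrow>
        cmod (D (etens a e) x - (\<xi> (ract X x (etens a e)) - \<eta> (lact X (etens a e) x))) \<le> r * vnorm X x"
    using hom.pullback_approx_semi_inner[OF amen D fin r] by metis
  note w = etens_in_carrier[OF v(1) eB(1)]
  show ?thesis
  proof (rule that)
    \<comment> \<open>Absorbing \<open>v \<otimes> e\<close> into the functionals leaves a pair that
      no longer depends on the individual \<open>c\<close>.\<close>
    show "dlact X (etens v e) \<xi> \<in> dual X" "dract X \<eta> (etens v e) \<in> dual X"
      using dlact_in_dual[OF M w p(1)] dract_in_dual[OF M w p(2)] .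
    fix c x assume c: "c \<in> \<Phi>" and x: "x \<in> vcarrier X"
    have cT: "c \<in> vcarrier T" using c Phi(2) by blast
    \<comment> \<open>Centrality acts here: the right action applies the first factor first, so
      \<open>v \<otimes> e\<close> must be moved behind \<open>c\<close>. On the left the order is
      already right.\<close>
    have "ract X x (amult T (etens v e) c) = ract X (ract X x c) (etens v e)"
      unfolding etens_central[OF v eB(1) e(2) cT] by (rule bimodule_mult_ract[OF M cT w x])
    moreover have "lact X (amult T (etens v e) c) x = lact X (etens v e) (lact X c x)"
      by (rule bimodule_mult_lact[OF M w cT x])
    ultimately show "cmod (D (amult T (etens v e) c) x -
        (dlact X (etens v e) \<xi> (ract X x c) - dract X \<eta> (etens v e) (lact X c x))) \<le> r * vnorm X x"
      using p(3)[OF imageI[OF c] x] bimodule_ract[OF M cT x] bimodule_lact[OF M cT x]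
      by (simp add: \<alpha>(2)[OF c, symmetric] dlact_def dract_def)
  qed
qed

text \<open>The approximated expression is linear in \<open>u\<close>, and the admissible pairs
  combine linearly with added errors, so induction over atoms applies. The tolerance varies in the
  induction because each step splits it in two.\<close>

lemma finite_support_derivation_approx:
  fixes A :: "'a calg" and B :: "('s \<Rightarrow> complex) calg" and X :: "('x, ('a \<Rightarrow> ('s \<Rightarrow> complex) \<Rightarrow> complex) \<Rightarrow> complex) bimod"
  assumes A: "banach_algebra A" and FA: "banach_function_algebra S B"
    and amen: "approx_semi_amenable TYPE('x) A"
    and M: "banach_bimodule (ptensor A B) X" and D: "cont_derivation (ptensor A B) X D"
    and v: "v \<in> vcarrier A" "central A v" and u: "u \<in> vcarrier B" "finite_support S u"
    and Phi: "finite \<Phi>" "\<Phi> \<subseteq> vcarrier (ptensor A B)" and r: "r > 0"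
  shows "\<exists>\<xi>\<in>dual X. \<exists>\<eta>\<in>dual X. \<forall>c\<in>\<Phi>. \<forall>x\<in>vcarrier X.
      cmod (D (amult (ptensor A B) (algebra_pair.etens A B v u) c) x -
        (\<xi> (ract X x c) - \<eta> (lact X c x))) \<le> r * vnorm X x"
proof -
  note B = function_algebra_banach[OF FA]
  interpret algebra_pair A B by unfold_locales (rule A B)+
  note X = bimodule_cbanach[OF M]
  have Dsmul: "D (vsmul T z c) x = z * D c x" if "c \<in> vcarrier T" for z c x
    using D that unfolding cont_derivation_def by simp
  have Dplus: "D (vplus T c d) x = D c x + D d x" if "c \<in> vcarrier T" "d \<in> vcarrier T" for c d x
    using D that unfolding cont_derivation_def by simp
  from FA u show ?thesis using r
  proof (induction u arbitrary: r rule: finite_support_induct)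
    case zero
    have "(\<lambda>x. 0) \<in> dual X" by (rule dualI[where K = 0]) auto
    moreover have "D (amult T (etens v (vzero B)) c) x = 0" if "c \<in> \<Phi>" for c x
      using that Phi(2) Dsmul[of c 0 x] by (auto simp: etens_mult_zero[OF v(1)])
    ultimately show ?case
      using zero cbanach_norm_ge_0[OF X] by (intro bexI[of _ "\<lambda>x. 0"]) auto
  next
    case (add u e z)
    have eB: "e \<in> vcarrier B" using add.hyps(2) unfolding atom_def by blast
    have ec: "central B e"
      unfolding central_def by (simp add: function_algebra_mult[OF FA] eB mult.commute)
    \<comment> \<open>The scalar \<open>z\<close> magnifies the error of the atom, which may
      therefore be at most half of \<open>r\<close> after multiplication; the added 1 covers
      \<open>z = 0\<close>.\<close>
    define q where "q = r / (2 * (cmod z + 1))"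
    have q: "q > 0" and zq: "cmod z * q \<le> r / 2"
      using add.prems by (auto simp: q_def field_simps add_pos_nonneg)
    obtain \<xi> \<eta> where p: "\<xi> \<in> dual X" "\<eta> \<in> dual X"
      "\<And>c x. c \<in> \<Phi> \<Longrightarrow> x \<in> vcarrier X \<Longrightarrow>
        cmod (D (amult T (etens v u) c) x - (\<xi> (ract X x c) - \<eta> (lact X c x))) \<le> r / 2 * vnorm X x"
      using add.IH[of "r / 2"] add.prems by auto
    obtain \<xi>' \<eta>' where p': "\<xi>' \<in> dual X" "\<eta>' \<in> dual X"
      "\<And>c x. c \<in> \<Phi> \<Longrightarrow> x \<in> vcarrier X \<Longrightarrow>
        cmod (D (amult T (etens v e) c) x - (\<xi>' (ract X x c) - \<eta>' (lact X c x))) \<le> q * vnorm X x"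
      using atom_derivation_approx[OF A B amen M D v add.hyps(2) ec Phi q] by metis
    have dual: "(\<lambda>x. \<xi> x + z * \<xi>' x) \<in> dual X" "(\<lambda>x. \<eta> x + z * \<eta>' x) \<in> dual X"
      using p(1,2) p'(1,2) by (auto intro!: dual_add[OF X] dual_scale[OF X])
    show ?case
    proof (rule bexI[OF _ dual(1)], rule bexI[OF _ dual(2)], intro ballI)
      fix c x assume c: "c \<in> \<Phi>" and x: "x \<in> vcarrier X"
      have cT: "c \<in> vcarrier T" using c Phi(2) by blast
      let ?d = "D (amult T (etens v u) c) x - (\<xi> (ract X x c) - \<eta> (lact X c x))"
      let ?d' = "D (amult T (etens v e) c) x - (\<xi>' (ract X x c) - \<eta>' (lact X c x))"
      have "D (amult T (etens v (vplus B u (vsmul B z e))) c) x =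
          D (amult T (etens v u) c) x + z * D (amult T (etens v e) c) x"
        using etens_mult_closed[OF v(1) add.hyps(1) cT] etens_mult_closed[OF v(1) eB cT]
        by (simp add: etens_mult_add[OF v(1) add.hyps(1) eB] Dplus Dsmul ptensor_smul_closed)
      then have eq: "D (amult T (etens v (vplus B u (vsmul B z e))) c) x -
          (\<xi> (ract X x c) + z * \<xi>' (ract X x c) - (\<eta> (lact X c x) + z * \<eta>' (lact X c x))) = ?d + z * ?d'"
        by (simp add: algebra_simps)
      have "cmod (z * ?d') \<le> r / 2 * vnorm X x"
      proof -
        have "cmod z * cmod ?d' \<le> cmod z * (q * vnorm X x)"
          using p'(3)[OF c x] by (intro mult_left_mono) auto
        also have "\<dots> \<le> r / 2 * vnorm X x"
          using mult_right_mono[OF zq cbanach_norm_ge_0[OF X x]] by (simp add: mult.assoc)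
        finally show ?thesis by (simp add: norm_mult)
      qed
      from norm_triangle_mono[OF p(3)[OF c x] this]
      show "cmod (D (amult T (etens v (vplus B u (vsmul B z e))) c) x -
          (\<xi> (ract X x c) + z * \<xi>' (ract X x c) - (\<eta> (lact X c x) + z * \<eta>' (lact X c x)))) \<le> r * vnorm X x"
        unfolding eq by simp
    qed
  qed
qed

theorem theorem5p6:
  fixes A :: "'a calg" and B :: "('s \<Rightarrow> complex) calg" and S :: "'s set"
  assumes "banach_algebra A"
    and "approx_semi_amenable TYPE('x) A"
    and "has_central_mbai A"
    and "banach_function_algebra S B"
    and "has_finite_support_mbai S B"
  shows "approx_semi_amenable TYPE('x) (ptensor A B)"
  unfolding approx_semi_amenable_def
proof (intro allI impI)
  note A = assms(1) and FA = assms(4)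
  note B = function_algebra_banach[OF FA]
  interpret algebra_pair A B by unfold_locales (rule A B)+
  fix X :: "('x, ('a \<Rightarrow> ('s \<Rightarrow> complex) \<Rightarrow> complex) \<Rightarrow> complex) bimod" and D
  assume M: "banach_bimodule T X" and D: "cont_derivation T X D"
  note X = bimodule_cbanach[OF M]
  obtain F where F: "mbai_with (central A) A F"
    using assms(3) unfolding has_central_mbai_def by blast
  obtain G where G: "mbai_with (finite_support S) B G"
    using assms(5) unfolding has_finite_support_mbai_def by blast
  have Ddual: "D c \<in> dual X" if "c \<in> vcarrier T" for c
    using D that unfolding cont_derivation_def by blast
  have Dsmul: "D (vsmul T z c) x = z * D c x" if "c \<in> vcarrier T" for z c x
    using D that unfolding cont_derivation_def by simp
  have Dplus: "D (vplus T c d) x = D c x + D d x" if "c \<in> vcarrier T" "d \<in> vcarrier T" for c d x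
    using D that unfolding cont_derivation_def by simp
  obtain K where K: "\<And>c. c \<in> vcarrier T \<Longrightarrow> dnorm X (D c) \<le> K * vnorm T c"
    using D unfolding cont_derivation_def by blast
  show "approx_semi_inner T X D"
  proof (rule approx_semi_innerI[OF M Ddual])
    fix \<Phi> and r :: real
    assume Phi: "finite \<Phi>" "\<Phi> \<subseteq> vcarrier T" and r: "r > 0"
    let ?good = "\<lambda>p. (fst p \<in> vcarrier A \<and> central A (fst p)) \<and> snd p \<in> vcarrier B \<and> finite_support S (snd p)"
    \<comment> \<open>Keeping \<open>K\<close> as a factor of a null net avoids dividing by a
      constant whose sign is unknown.\<close>
    have ev: "\<forall>\<^sub>F p in F \<times>\<^sub>F G. K * vnorm T (vminus T (amult T (etens (fst p) (snd p)) c) c) < r / 2"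
      if "c \<in> \<Phi>" for c
    proof -
      have "c \<in> vcarrier T" using that Phi(2) by blast
      from tendsto_mult_left[OF ptensor_approximate_identity[OF F G this], of K]
      have "((\<lambda>p. K * vnorm T (vminus T (amult T (etens (fst p) (snd p)) c) c)) \<longlongrightarrow> 0) (F \<times>\<^sub>F G)"
        by (simp add: case_prod_unfold)
      then show ?thesis using r by (intro order_tendstoD(2)) auto
    qed
    have good: "\<forall>\<^sub>F p in F \<times>\<^sub>F G. ?good p"
      using F G unfolding mbai_with_def eventually_prod_filter by auto
    have "F \<times>\<^sub>F G \<noteq> bot"
      using F G unfolding mbai_with_def by (simp add: prod_filter_eq_bot)
    \<comment> \<open>Finiteness of \<open>\<Phi>\<close> provides a single pair that works for all
      its elements.\<close>
    from eventually_happens'[OF this eventually_conj[OF good eventually_ball_finite[OF Phi(1)]]] ev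
    obtain v u where v: "v \<in> vcarrier A" "central A v" and u: "u \<in> vcarrier B" "finite_support S u"
      and close: "\<And>c. c \<in> \<Phi> \<Longrightarrow> K * vnorm T (vminus T (amult T (etens v u) c) c) < r / 2"
      by force
    have "r / 2 > 0" using r by simp
    from finite_support_derivation_approx[OF A FA assms(2) M D v u Phi this]
    obtain \<xi> \<eta> where p: "\<xi> \<in> dual X" "\<eta> \<in> dual X"
      "\<And>c x. c \<in> \<Phi> \<Longrightarrow> x \<in> vcarrier X \<Longrightarrow>
        cmod (D (amult T (etens v u) c) x - (\<xi> (ract X x c) - \<eta> (lact X c x))) \<le> r / 2 * vnorm X x"
      by blast
    show "\<exists>\<xi>\<in>dual X. \<exists>\<eta>\<in>dual X. \<forall>c\<in>\<Phi>. \<forall>x\<in>vcarrier X.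
        cmod (D c x - (\<xi> (ract X x c) - \<eta> (lact X c x))) \<le> r * vnorm X x"
    proof (rule bexI[OF _ p(1)], rule bexI[OF _ p(2)], intro ballI)
      fix c x assume c: "c \<in> \<Phi>" and x: "x \<in> vcarrier X"
      have cT: "c \<in> vcarrier T" using c Phi(2) by blast
      let ?wc = "amult T (etens v u) c"
      have wc: "?wc \<in> vcarrier T" by (rule etens_mult_closed[OF v(1) u(1) cT])
      have m: "vminus T ?wc c \<in> vcarrier T"
        unfolding vminus_def by (intro ptensor_plus_closed ptensor_smul_closed wc cT)
      have "D (vminus T ?wc c) x = D ?wc x - D c x"
        by (simp add: vminus_def Dplus[OF wc ptensor_smul_closed[OF cT]] Dsmul[OF cT])
      \<comment> \<open>Continuity of \<open>D\<close>, applied to the defect, pays one half of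
        \<open>r\<close>; the other half is the error of the semi-inner approximation at
        \<open>(v \<otimes> u) c\<close>.\<close>
      then have "cmod (D ?wc x - D c x) \<le> dnorm X (D (vminus T ?wc c)) * vnorm X x"
        using dnorm_bound[OF X Ddual[OF m] x] by simp
      also have "\<dots> \<le> r / 2 * vnorm X x"
        using K[OF m] close[OF c] cbanach_norm_ge_0[OF X x] by (intro mult_right_mono) auto
      finally have "cmod (D c x - D ?wc x) \<le> r / 2 * vnorm X x"
        by (simp add: norm_minus_commute)
      from norm_triangle_mono[OF this p(3)[OF c x]]
      show "cmod (D c x - (\<xi> (ract X x c) - \<eta> (lact X c x))) \<le> r * vnorm X x"
        by (simp add: algebra_simps)
    qed
  qed
qed

end
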